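(* Let $p$ be a prime, $q$ a positive power of $p$, $X$ a Noetherian $F$-finite $\mathbf{F}_p$-scheme, and $\mathcal{I}\subset\mathcal{O}_X$ a quasi-coherent ideal sheaf that is locally generated by a single element. Let $(M,C)$ be a coherent $q$-Cartier module on $X$, and let $N\subset M$ be a $C$-preperiodic coherent $\mathcal{O}_X$-submodule. Assume that there exists a constant $L\ge0$ such that $\#\bigl(\nu_{\mathcal{I}}(q^m;N)\cap[0,q^m)\bigr)\le L$ for all integers $m\ge1$. Then the following hold. (1) The set $\nu_{\mathcal{I}}(q^\infty;N)$ is contained in $\mathbf{Z}_{(p)}=\mathbf{Z}_p\cap\mathbf{Q}$. (2) Assume further that there exists an integer $j>0$ such that $N=C^j(N)$. Then $\nu_{\mathcal{I}}(q^\infty;N)\subset\mathbf{Z}_{(p)}\cap[-1,0]$.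
   Context: An $\mathbf{F}_p$-scheme is $F$-finite if its Frobenius is finite. A $q$-Cartier module on $X$ is a pair $(M,C)$ with $M$ an $\mathcal{O}_X$-module and $C\colon M\to M$ an additive endomorphism with $C(a^qx)=aC(x)$ for all local sections $a\in\mathcal{O}_X$, $x\in M$. It is coherent if $M$ is coherent over $\mathcal{O}_X$. A coherent $\mathcal{O}_X$-submodule $N\subset M$ is $C$-preperiodic if there exist integers $i,j>0$ with $C^i(N)=C^{i+j}(N)$. For an $\mathcal{O}_X$-submodule $N\subset M$ and $m\ge1$, $$\nu_{\mathcal{I}}(q^m;N)=\{n\in\mathbf{Z}_{\ge0}\mid C^m(\mathcal{I}^nN)\ne C^m(\mathcal{I}^{n+1}N)\}.$$ $\nu_{\mathcal{I}}(q^\infty;N)$ is the set of all $\alpha\in\mathbf{Z}_p$ such that for every integer $m\ge1$ there is $n\in\nu_{\mathcal{I}}(q^m;N)$ with $\alpha-n\in q^m\mathbf{Z}_p$. *)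

theory Defs
  imports "HOL-Computational_Algebra.Primes" "HOL-Analysis.Abstract_Topology"
    "HOL-Algebra.Ring_Divisibility" "HOL-Algebra.Generated_Groups"
begin

section \<open>Sheaves of rings and of modules\<close>

text \<open>
  Sections over an open set \<open>U\<close> form a ring (or module) with explicit carrier.  The values of the
  functions below at sets that are not open are irrelevant.
\<close>

record ('a, 'b) ringed_space =
  pts :: "'a topology"
  sec :: "'a set \<Rightarrow> 'b ring"
  res :: "'a set \<Rightarrow> 'a set \<Rightarrow> 'b \<Rightarrow> 'b"

record ('a, 'b, 'm) mod_sheaf =
  msec :: "'a set \<Rightarrow> ('b, 'm) module"
  mres :: "'a set \<Rightarrow> 'a set \<Rightarrow> 'm \<Rightarrow> 'm"

definition locally_on :: "'a topology \<Rightarrow> 'a set \<Rightarrow> ('a set \<Rightarrow> bool) \<Rightarrow> bool" where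
  "locally_on T U Q \<longleftrightarrow> (\<forall>x\<in>U. \<exists>V. openin T V \<and> x \<in> V \<and> V \<subseteq> U \<and> Q V)"

text \<open>
  The gluing axiom includes the empty cover, so there is exactly one section over the empty set.
\<close>

definition set_sheaf ::
  "'a topology \<Rightarrow> ('a set \<Rightarrow> 's set) \<Rightarrow> ('a set \<Rightarrow> 'a set \<Rightarrow> 's \<Rightarrow> 's) \<Rightarrow> bool" where
  "set_sheaf T F r \<longleftrightarrow>
     (\<forall>U V. openin T U \<and> openin T V \<and> V \<subseteq> U \<longrightarrow> r U V \<in> F U \<rightarrow> F V) \<and>
     (\<forall>U. openin T U \<longrightarrow> (\<forall>x\<in>F U. r U U x = x)) \<and>
     (\<forall>U V W. openin T U \<and> openin T V \<and> openin T W \<and> W \<subseteq> V \<and> V \<subseteq> U \<longrightarrow>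
        (\<forall>x\<in>F U. r V W (r U V x) = r U W x)) \<and>
     (\<forall>\<U> s. (\<forall>U\<in>\<U>. openin T U \<and> s U \<in> F U) \<and>
        (\<forall>U\<in>\<U>. \<forall>V\<in>\<U>. r U (U \<inter> V) (s U) = r V (U \<inter> V) (s V)) \<longrightarrow>
        (\<exists>!x. x \<in> F (\<Union>\<U>) \<and> (\<forall>U\<in>\<U>. r (\<Union>\<U>) U x = s U)))"

definition is_ringed_space :: "('a, 'b) ringed_space \<Rightarrow> bool" where
  "is_ringed_space X \<longleftrightarrow>
     set_sheaf (pts X) (\<lambda>U. carrier (sec X U)) (res X) \<and>
     (\<forall>U. openin (pts X) U \<longrightarrow> cring (sec X U)) \<and>
     (\<forall>U V. openin (pts X) U \<and> openin (pts X) V \<and> V \<subseteq> U \<longrightarrow>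
        res X U V \<in> ring_hom (sec X U) (sec X V))"

definition is_mod_sheaf :: "('a, 'b) ringed_space \<Rightarrow> ('a, 'b, 'm) mod_sheaf \<Rightarrow> bool" where
  "is_mod_sheaf X M \<longleftrightarrow>
     set_sheaf (pts X) (\<lambda>U. carrier (msec M U)) (mres M) \<and>
     (\<forall>U. openin (pts X) U \<longrightarrow> module (sec X U) (msec M U)) \<and>
     (\<forall>U V. openin (pts X) U \<and> openin (pts X) V \<and> V \<subseteq> U \<longrightarrow>
        mres M U V \<in> hom (add_monoid (msec M U)) (add_monoid (msec M V)) \<and>
        (\<forall>a\<in>carrier (sec X U). \<forall>x\<in>carrier (msec M U).
           mres M U V (a \<odot>\<^bsub>msec M U\<^esub> x) = res X U V a \<odot>\<^bsub>msec M V\<^esub> mres M U V x))"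

definition open_subspace :: "('a, 'b) ringed_space \<Rightarrow> 'a set \<Rightarrow> ('a, 'b) ringed_space" where
  "open_subspace X U = X\<lparr>pts := subtopology (pts X) U\<rparr>"

definition preim :: "('a, 'b) ringed_space \<Rightarrow> ('a \<Rightarrow> 'c) \<Rightarrow> 'c set \<Rightarrow> 'a set" where
  "preim X g W = {x \<in> topspace (pts X). g x \<in> W}"

definition ringed_space_iso ::
  "('a, 'b) ringed_space \<Rightarrow> ('c, 'd) ringed_space \<Rightarrow> ('a \<Rightarrow> 'c) \<Rightarrow> ('c set \<Rightarrow> 'd \<Rightarrow> 'b) \<Rightarrow> bool" where
  "ringed_space_iso X Y g \<phi> \<longleftrightarrow>
     homeomorphic_map (pts X) (pts Y) g \<and>
     (\<forall>W. openin (pts Y) W \<longrightarrow> \<phi> W \<in> ring_iso (sec Y W) (sec X (preim X g W))) \<and>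
     (\<forall>W V. openin (pts Y) W \<and> openin (pts Y) V \<and> V \<subseteq> W \<longrightarrow>
        (\<forall>s\<in>carrier (sec Y W).
           res X (preim X g W) (preim X g V) (\<phi> W s) = \<phi> V (res Y W V s)))"

text \<open>An isomorphism from the sheaf \<open>M\<close> on \<open>X\<close> to \<open>M'\<close> on \<open>Y\<close>, over the isomorphism \<open>(g, \<phi>)\<close>.\<close>

definition mod_sheaf_iso ::
  "('a, 'b) ringed_space \<Rightarrow> ('a, 'b, 'm) mod_sheaf \<Rightarrow> ('c, 'd) ringed_space \<Rightarrow> ('c, 'd, 'n) mod_sheaf \<Rightarrow>
   ('a \<Rightarrow> 'c) \<Rightarrow> ('c set \<Rightarrow> 'd \<Rightarrow> 'b) \<Rightarrow> ('c set \<Rightarrow> 'n \<Rightarrow> 'm) \<Rightarrow> bool" where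
  "mod_sheaf_iso X M Y M' g \<phi> \<psi> \<longleftrightarrow>
     (\<forall>W. openin (pts Y) W \<longrightarrow>
        \<psi> W \<in> iso (add_monoid (msec M' W)) (add_monoid (msec M (preim X g W))) \<and>
        (\<forall>a\<in>carrier (sec Y W). \<forall>s\<in>carrier (msec M' W).
           \<psi> W (a \<odot>\<^bsub>msec M' W\<^esub> s) = \<phi> W a \<odot>\<^bsub>msec M (preim X g W)\<^esub> \<psi> W s)) \<and>
     (\<forall>W V. openin (pts Y) W \<and> openin (pts Y) V \<and> V \<subseteq> W \<longrightarrow>
        (\<forall>s\<in>carrier (msec M' W).
           mres M (preim X g W) (preim X g V) (\<psi> W s) = \<psi> V (mres M' W V s)))"


section \<open>Affine schemes and the sheaf associated with a module\<close>

definition scalars_along :: "('b \<Rightarrow> 'd) \<Rightarrow> 'd ring \<Rightarrow> ('b, 'd) module" where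
  "scalars_along \<phi> B =
     \<lparr>carrier = carrier B, mult = mult B, one = one B, zero = zero B, add = add B,
      smult = (\<lambda>a x. \<phi> a \<otimes>\<^bsub>B\<^esub> x)\<rparr>"

abbreviation ring_module :: "'b ring \<Rightarrow> ('b, 'b) module" where
  "ring_module A \<equiv> scalars_along (\<lambda>a. a) A"

definition fin_gen_module :: "'b ring \<Rightarrow> ('b, 'm) module \<Rightarrow> bool" where
  "fin_gen_module A N \<longleftrightarrow> module A N \<and>
     (\<exists>S. finite S \<and> S \<subseteq> carrier N \<and>
        (\<forall>x\<in>carrier N. \<exists>c\<in>S \<rightarrow> carrier A. x = finsum N (\<lambda>s. c s \<odot>\<^bsub>N\<^esub> s) S))"

definition spec :: "'b ring \<Rightarrow> 'b set set" where
  "spec A = {P. primeideal P A}"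

definition zariski :: "'b ring \<Rightarrow> 'b set topology" where
  "zariski A = topology (\<lambda>D. \<exists>S\<subseteq>carrier A. D = {P \<in> spec A. \<not> S \<subseteq> P})"

lemma istopology_zariski:
  "istopology (\<lambda>D. \<exists>S\<subseteq>carrier A. D = {P \<in> spec A. \<not> S \<subseteq> P})" (is "istopology ?op")
  unfolding istopology_def
proof (intro conjI allI impI)
  fix D E assume "?op D" "?op E"
  then obtain S T where S: "S \<subseteq> carrier A" "D = {P \<in> spec A. \<not> S \<subseteq> P}"
    and T: "T \<subseteq> carrier A" "E = {P \<in> spec A. \<not> T \<subseteq> P}" by blast
  define R where "R = {s \<otimes>\<^bsub>A\<^esub> t | s t. s \<in> S \<and> t \<in> T}"
  have in_iff: "R \<subseteq> P \<longleftrightarrow> S \<subseteq> P \<or> T \<subseteq> P" if "P \<in> spec A" for P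
  proof -
    interpret primeideal P A using that by (simp add: spec_def)
    show ?thesis
    proof
      assume RP: "R \<subseteq> P"
      show "S \<subseteq> P \<or> T \<subseteq> P"
      proof (rule ccontr)
        assume "\<not> (S \<subseteq> P \<or> T \<subseteq> P)"
        then obtain s t where "s \<in> S" "s \<notin> P" "t \<in> T" "t \<notin> P" by blast
        then show False using RP S(1) T(1) I_prime[of s t] unfolding R_def by blast
      qed
    next
      assume "S \<subseteq> P \<or> T \<subseteq> P"
      then show "R \<subseteq> P"
        unfolding R_def using S(1) T(1) I_l_closed I_r_closed by blast
    qed
  qed
  have RA: "R \<subseteq> carrier A \<or> D \<inter> E = {}"
  proof (cases "D \<inter> E = {}")
    case False
    then obtain P where "P \<in> spec A" using S(2) by blast
    then interpret primeideal P A by (simp add: spec_def)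
    show ?thesis unfolding R_def using S(1) T(1) by blast
  qed simp
  show "?op (D \<inter> E)"
  proof (cases "D \<inter> E = {}")
    case True
    then show ?thesis by (intro exI[of _ "{}"]) simp
  next
    case False
    moreover have "D \<inter> E = {P \<in> spec A. \<not> R \<subseteq> P}" using S(2) T(2) in_iff by blast
    ultimately show ?thesis using RA by blast
  qed
next
  fix \<D> assume "\<forall>D\<in>\<D>. ?op D"
  then obtain S where S: "\<And>D. D \<in> \<D> \<Longrightarrow> S D \<subseteq> carrier A \<and> D = {P \<in> spec A. \<not> S D \<subseteq> P}"
    by metis
  have "\<Union>\<D> = {P \<in> spec A. \<not> (\<Union>D\<in>\<D>. S D) \<subseteq> P}"
  proof (intro equalityI subsetI)
    fix P assume "P \<in> \<Union>\<D>"
    then obtain D where D: "D \<in> \<D>" "P \<in> D" by blast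
    then have "P \<in> {P \<in> spec A. \<not> S D \<subseteq> P}" using S by blast
    then show "P \<in> {P \<in> spec A. \<not> (\<Union>D\<in>\<D>. S D) \<subseteq> P}" using D(1) by blast
  next
    fix P assume "P \<in> {P \<in> spec A. \<not> (\<Union>D\<in>\<D>. S D) \<subseteq> P}"
    then obtain D where D: "D \<in> \<D>" "\<not> S D \<subseteq> P" "P \<in> spec A" by blast
    then have "P \<in> D" using S[OF D(1)] by blast
    then show "P \<in> \<Union>\<D>" using D(1) by blast
  qed
  then show "?op (\<Union>\<D>)" using S by (intro exI[of _ "\<Union>D\<in>\<D>. S D"]) blast
qed

lemma openin_zariski: "openin (zariski A) D \<longleftrightarrow> (\<exists>S\<subseteq>carrier A. D = {P \<in> spec A. \<not> S \<subseteq> P})"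
  unfolding zariski_def by (simp add: topology_inverse' istopology_zariski)

text \<open>
  \<open>loc_frac A N P x s\<close> is the class of \<open>x/s\<close> in the localization of the \<open>A\<close>-module \<open>N\<close> at the prime \<open>P\<close>.
  The localization of \<open>A\<close> itself is the case \<open>N = ring_module A\<close>.
\<close>

definition loc_frac :: "'b ring \<Rightarrow> ('b, 'm) module \<Rightarrow> 'b set \<Rightarrow> 'm \<Rightarrow> 'b \<Rightarrow> ('m \<times> 'b) set" where
  "loc_frac A N P x s =
     {(y, t). y \<in> carrier N \<and> t \<in> carrier A - P \<and>
        (\<exists>u\<in>carrier A - P. (u \<otimes>\<^bsub>A\<^esub> t) \<odot>\<^bsub>N\<^esub> x = (u \<otimes>\<^bsub>A\<^esub> s) \<odot>\<^bsub>N\<^esub> y)}"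

definition loc_carrier :: "'b ring \<Rightarrow> ('b, 'm) module \<Rightarrow> 'b set \<Rightarrow> ('m \<times> 'b) set set" where
  "loc_carrier A N P = {loc_frac A N P x s | x s. x \<in> carrier N \<and> s \<in> carrier A - P}"

text \<open>
  The operations on classes; on elements of \<open>loc_carrier\<close>, all sets in each union coincide.
  \<open>loc_smult\<close> with \<open>N = ring_module A\<close> is the multiplication of the local ring.
\<close>

definition loc_add ::
  "'b ring \<Rightarrow> ('b, 'm) module \<Rightarrow> 'b set \<Rightarrow> ('m \<times> 'b) set \<Rightarrow> ('m \<times> 'b) set \<Rightarrow> ('m \<times> 'b) set" where
  "loc_add A N P \<xi> \<eta> = (\<Union>(x, s)\<in>\<xi>. \<Union>(y, t)\<in>\<eta>.
     loc_frac A N P (t \<odot>\<^bsub>N\<^esub> x \<oplus>\<^bsub>N\<^esub> s \<odot>\<^bsub>N\<^esub> y) (s \<otimes>\<^bsub>A\<^esub> t))"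

definition loc_smult ::
  "'b ring \<Rightarrow> ('b, 'm) module \<Rightarrow> 'b set \<Rightarrow> ('b \<times> 'b) set \<Rightarrow> ('m \<times> 'b) set \<Rightarrow> ('m \<times> 'b) set" where
  "loc_smult A N P \<alpha> \<xi> = (\<Union>(a, s)\<in>\<alpha>. \<Union>(x, t)\<in>\<xi>. loc_frac A N P (a \<odot>\<^bsub>N\<^esub> x) (s \<otimes>\<^bsub>A\<^esub> t))"

definition tilde_sections ::
  "'b ring \<Rightarrow> ('b, 'm) module \<Rightarrow> 'b set set \<Rightarrow> ('b set \<Rightarrow> ('m \<times> 'b) set) set" where
  "tilde_sections A N D =
     {\<sigma> \<in> (\<Pi>\<^sub>E P\<in>D. loc_carrier A N P).
        locally_on (zariski A) D (\<lambda>V. \<exists>x\<in>carrier N. \<exists>t\<in>carrier A.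
          \<forall>P\<in>V. t \<notin> P \<and> \<sigma> P = loc_frac A N P x t)}"

definition Spec :: "'b ring \<Rightarrow> ('b set, 'b set \<Rightarrow> ('b \<times> 'b) set) ringed_space" where
  "Spec A =
     \<lparr>pts = zariski A,
      sec = (\<lambda>D.
        \<lparr>carrier = tilde_sections A (ring_module A) D,
         mult = (\<lambda>\<sigma> \<tau>. \<lambda>P\<in>D. loc_smult A (ring_module A) P (\<sigma> P) (\<tau> P)),
         one = (\<lambda>P\<in>D. loc_frac A (ring_module A) P \<one>\<^bsub>A\<^esub> \<one>\<^bsub>A\<^esub>),
         zero = (\<lambda>P\<in>D. loc_frac A (ring_module A) P \<zero>\<^bsub>A\<^esub> \<one>\<^bsub>A\<^esub>),
         add = (\<lambda>\<sigma> \<tau>. \<lambda>P\<in>D. loc_add A (ring_module A) P (\<sigma> P) (\<tau> P))\<rparr>),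
      res = (\<lambda>D E \<sigma>. restrict \<sigma> E)\<rparr>"

text \<open>The fields \<open>mult\<close> and \<open>one\<close> of a module record have no meaning for a module.\<close>

definition tilde ::
  "'b ring \<Rightarrow> ('b, 'm) module \<Rightarrow>
   ('b set, 'b set \<Rightarrow> ('b \<times> 'b) set, 'b set \<Rightarrow> ('m \<times> 'b) set) mod_sheaf" where
  "tilde A N =
     \<lparr>msec = (\<lambda>D.
        \<lparr>carrier = tilde_sections A N D,
         mult = undefined,
         one = undefined,
         zero = (\<lambda>P\<in>D. loc_frac A N P \<zero>\<^bsub>N\<^esub> \<one>\<^bsub>A\<^esub>),
         add = (\<lambda>\<sigma> \<tau>. \<lambda>P\<in>D. loc_add A N P (\<sigma> P) (\<tau> P)),
         smult = (\<lambda>\<alpha> \<sigma>. \<lambda>P\<in>D. loc_smult A N P (\<alpha> P) (\<sigma> P))\<rparr>),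
      mres = (\<lambda>D E \<sigma>. restrict \<sigma> E)\<rparr>"


section \<open>Schemes and coherent sheaves\<close>

text \<open>
  \<open>affine_chart X U A g \<phi>\<close>: the open subspace \<open>U\<close> is isomorphic to \<open>Spec A\<close> through \<open>(g, \<phi>)\<close>.
  An isomorphism of ringed spaces onto \<open>Spec A\<close> makes \<open>U\<close> locally ringed and is automatically local,
  so stalks are not needed.  As \<open>A\<close> is isomorphic to the ring of sections over \<open>U\<close>, taking \<open>A\<close> over
  the type of sections of \<open>X\<close> loses no generality.  The same applies to the modules \<open>N\<close> below.
\<close>

definition affine_chart ::
  "('a, 'b) ringed_space \<Rightarrow> 'a set \<Rightarrow> 'b ring \<Rightarrow> ('a \<Rightarrow> 'b set) \<Rightarrow>
   ('b set set \<Rightarrow> ('b set \<Rightarrow> ('b \<times> 'b) set) \<Rightarrow> 'b) \<Rightarrow> bool" where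
  "affine_chart X U A g \<phi> \<longleftrightarrow>
     openin (pts X) U \<and> cring A \<and> ringed_space_iso (open_subspace X U) (Spec A) g \<phi>"

definition affine_open :: "('a, 'b) ringed_space \<Rightarrow> 'a set \<Rightarrow> bool" where
  "affine_open X U \<longleftrightarrow> (\<exists>A g \<phi>. affine_chart X U A g \<phi>)"

definition scheme :: "('a, 'b) ringed_space \<Rightarrow> bool" where
  "scheme X \<longleftrightarrow> is_ringed_space X \<and> (\<forall>x\<in>topspace (pts X). \<exists>U. x \<in> U \<and> affine_open X U)"

definition noetherian_scheme :: "('a, 'b) ringed_space \<Rightarrow> bool" where
  "noetherian_scheme X \<longleftrightarrow>
     scheme X \<and> compact_space (pts X) \<and>
     (\<forall>x\<in>topspace (pts X). \<exists>U A g \<phi>. x \<in> U \<and> affine_chart X U A g \<phi> \<and> noetherian_ring A)"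

text \<open>A scheme has a (unique) morphism to the spectrum of \<open>\<int>/p\<close> iff \<open>p = 0\<close> in its structure sheaf.\<close>

definition Fp_scheme :: "nat \<Rightarrow> ('a, 'b) ringed_space \<Rightarrow> bool" where
  "Fp_scheme p X \<longleftrightarrow> scheme X \<and>
     (\<forall>U. openin (pts X) U \<longrightarrow> [p] \<cdot>\<^bsub>sec X U\<^esub> \<one>\<^bsub>sec X U\<^esub> = \<zero>\<^bsub>sec X U\<^esub>)"

text \<open>Finiteness of a morphism of schemes \<open>X \<rightarrow> Y\<close> given by \<open>f\<close> on points and \<open>\<phi>\<close> on sections.\<close>

definition finite_morphism ::
  "('a, 'b) ringed_space \<Rightarrow> ('c, 'd) ringed_space \<Rightarrow> ('a \<Rightarrow> 'c) \<Rightarrow> ('c set \<Rightarrow> 'd \<Rightarrow> 'b) \<Rightarrow> bool" where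
  "finite_morphism X Y f \<phi> \<longleftrightarrow>
     (\<forall>y\<in>topspace (pts Y). \<exists>V. y \<in> V \<and> affine_open Y V \<and> affine_open X (preim X f V) \<and>
        fin_gen_module (sec Y V) (scalars_along (\<phi> V) (sec X (preim X f V))))"

text \<open>The Frobenius is the identity on points and the \<open>p\<close>-th power map on sections.\<close>

definition F_finite :: "nat \<Rightarrow> ('a, 'b) ringed_space \<Rightarrow> bool" where
  "F_finite p X \<longleftrightarrow> Fp_scheme p X \<and> finite_morphism X X (\<lambda>x. x) (\<lambda>U a. a [^]\<^bsub>sec X U\<^esub> p)"

text \<open>On a Noetherian scheme, coherent means quasi-coherent with finitely generated local modules.\<close>

definition quasi_coherent :: "('a, 'b) ringed_space \<Rightarrow> ('a, 'b, 'm) mod_sheaf \<Rightarrow> bool" where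
  "quasi_coherent X M \<longleftrightarrow> is_mod_sheaf X M \<and>
     (\<forall>x\<in>topspace (pts X). \<exists>U A g \<phi> (N :: ('b, 'm) module) \<psi>. x \<in> U \<and> affine_chart X U A g \<phi> \<and>
        module A N \<and> mod_sheaf_iso (open_subspace X U) M (Spec A) (tilde A N) g \<phi> \<psi>)"

definition coherent :: "('a, 'b) ringed_space \<Rightarrow> ('a, 'b, 'm) mod_sheaf \<Rightarrow> bool" where
  "coherent X M \<longleftrightarrow> is_mod_sheaf X M \<and>
     (\<forall>x\<in>topspace (pts X). \<exists>U A g \<phi> (N :: ('b, 'm) module) \<psi>. x \<in> U \<and> affine_chart X U A g \<phi> \<and>
        fin_gen_module A N \<and> mod_sheaf_iso (open_subspace X U) M (Spec A) (tilde A N) g \<phi> \<psi>)"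


section \<open>Submodules and ideal sheaves\<close>

definition submodule_sheaf ::
  "('a, 'b) ringed_space \<Rightarrow> ('a, 'b, 'm) mod_sheaf \<Rightarrow> ('a set \<Rightarrow> 'm set) \<Rightarrow> bool" where
  "submodule_sheaf X M N \<longleftrightarrow>
     (\<forall>U. openin (pts X) U \<longrightarrow> submodule (N U) (sec X U) (msec M U)) \<and>
     (\<forall>U V. openin (pts X) U \<and> openin (pts X) V \<and> V \<subseteq> U \<longrightarrow> mres M U V \<in> N U \<rightarrow> N V) \<and>
     (\<forall>U. openin (pts X) U \<longrightarrow> (\<forall>x\<in>carrier (msec M U).
        locally_on (pts X) U (\<lambda>V. mres M U V x \<in> N V) \<longrightarrow> x \<in> N U))"

definition subsheaf_eq ::
  "('a, 'b) ringed_space \<Rightarrow> ('a set \<Rightarrow> 'm set) \<Rightarrow> ('a set \<Rightarrow> 'm set) \<Rightarrow> bool" where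
  "subsheaf_eq X N N' \<longleftrightarrow> (\<forall>U. openin (pts X) U \<longrightarrow> N U = N' U)"

definition as_mod_sheaf ::
  "('a, 'b, 'm) mod_sheaf \<Rightarrow> ('a set \<Rightarrow> 'm set) \<Rightarrow> ('a, 'b, 'm) mod_sheaf" where
  "as_mod_sheaf M N = M\<lparr>msec := (\<lambda>U. (msec M U)\<lparr>carrier := N U\<rparr>)\<rparr>"

definition struct_sheaf :: "('a, 'b) ringed_space \<Rightarrow> ('a, 'b, 'b) mod_sheaf" where
  "struct_sheaf X = \<lparr>msec = (\<lambda>U. ring_module (sec X U)), mres = res X\<rparr>"

abbreviation ideal_sheaf :: "('a, 'b) ringed_space \<Rightarrow> ('a set \<Rightarrow> 'b set) \<Rightarrow> bool" where
  "ideal_sheaf X \<I> \<equiv> submodule_sheaf X (struct_sheaf X) \<I>"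

definition locally_principal :: "('a, 'b) ringed_space \<Rightarrow> ('a set \<Rightarrow> 'b set) \<Rightarrow> bool" where
  "locally_principal X \<I> \<longleftrightarrow>
     (\<forall>x\<in>topspace (pts X). \<exists>U. openin (pts X) U \<and> x \<in> U \<and>
        (\<exists>f\<in>\<I> U. \<forall>V. openin (pts X) V \<and> V \<subseteq> U \<longrightarrow>
           (\<forall>s\<in>\<I> V. locally_on (pts X) V
              (\<lambda>W. \<exists>a\<in>carrier (sec X W). res X V W s = a \<otimes>\<^bsub>sec X W\<^esub> res X U W f))))"

text \<open>The product is the image of the sheaf \<open>\<I> \<otimes> N\<close> in \<open>M\<close>.\<close>

definition ideal_smult ::
  "('a, 'b) ringed_space \<Rightarrow> ('a, 'b, 'm) mod_sheaf \<Rightarrow> ('a set \<Rightarrow> 'b set) \<Rightarrow> ('a set \<Rightarrow> 'm set) \<Rightarrow>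
   'a set \<Rightarrow> 'm set" where
  "ideal_smult X M \<I> N U =
     {x \<in> carrier (msec M U). locally_on (pts X) U
        (\<lambda>V. mres M U V x \<in>
           generate (add_monoid (msec M V)) {a \<odot>\<^bsub>msec M V\<^esub> y | a y. a \<in> \<I> V \<and> y \<in> N V})}"

primrec ideal_pow ::
  "('a, 'b) ringed_space \<Rightarrow> ('a set \<Rightarrow> 'b set) \<Rightarrow> nat \<Rightarrow> 'a set \<Rightarrow> 'b set" where
  "ideal_pow X \<I> 0 = (\<lambda>U. carrier (sec X U))"
| "ideal_pow X \<I> (Suc n) = ideal_smult X (struct_sheaf X) \<I> (ideal_pow X \<I> n)"


section \<open>Cartier modules\<close>

definition cartier_module ::
  "nat \<Rightarrow> ('a, 'b) ringed_space \<Rightarrow> ('a, 'b, 'm) mod_sheaf \<Rightarrow> ('a set \<Rightarrow> 'm \<Rightarrow> 'm) \<Rightarrow> bool" where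
  "cartier_module q X M C \<longleftrightarrow> is_mod_sheaf X M \<and>
     (\<forall>U. openin (pts X) U \<longrightarrow>
        C U \<in> hom (add_monoid (msec M U)) (add_monoid (msec M U)) \<and>
        (\<forall>a\<in>carrier (sec X U). \<forall>x\<in>carrier (msec M U).
           C U ((a [^]\<^bsub>sec X U\<^esub> q) \<odot>\<^bsub>msec M U\<^esub> x) = a \<odot>\<^bsub>msec M U\<^esub> C U x)) \<and>
     (\<forall>U V. openin (pts X) U \<and> openin (pts X) V \<and> V \<subseteq> U \<longrightarrow>
        (\<forall>x\<in>carrier (msec M U). mres M U V (C U x) = C V (mres M U V x)))"

text \<open>The image sheaf of \<open>N\<close> under the \<open>m\<close>-th iterate of \<open>C\<close>.\<close>

definition cartier_image ::
  "('a, 'b) ringed_space \<Rightarrow> ('a, 'b, 'm) mod_sheaf \<Rightarrow> ('a set \<Rightarrow> 'm \<Rightarrow> 'm) \<Rightarrow> nat \<Rightarrow>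
   ('a set \<Rightarrow> 'm set) \<Rightarrow> 'a set \<Rightarrow> 'm set" where
  "cartier_image X M C m N U =
     {x \<in> carrier (msec M U). locally_on (pts X) U (\<lambda>V. mres M U V x \<in> (C V ^^ m) ` N V)}"

definition preperiodic ::
  "('a, 'b) ringed_space \<Rightarrow> ('a, 'b, 'm) mod_sheaf \<Rightarrow> ('a set \<Rightarrow> 'm \<Rightarrow> 'm) \<Rightarrow> ('a set \<Rightarrow> 'm set) \<Rightarrow> bool"
  where
  "preperiodic X M C N \<longleftrightarrow>
     (\<exists>i>0. \<exists>j>0. subsheaf_eq X (cartier_image X M C i N) (cartier_image X M C (i + j) N))"

text \<open>This is the set \<open>\<nu>\<^sub>\<I>(q^m; N)\<close>, which depends on \<open>q\<close> only through \<open>C\<close>.\<close>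

definition nu ::
  "('a, 'b) ringed_space \<Rightarrow> ('a, 'b, 'm) mod_sheaf \<Rightarrow> ('a set \<Rightarrow> 'm \<Rightarrow> 'm) \<Rightarrow> ('a set \<Rightarrow> 'b set) \<Rightarrow>
   nat \<Rightarrow> ('a set \<Rightarrow> 'm set) \<Rightarrow> nat set" where
  "nu X M C \<I> m N = {n. \<not> subsheaf_eq X
     (cartier_image X M C m (ideal_smult X M (ideal_pow X \<I> n) N))
     (cartier_image X M C m (ideal_smult X M (ideal_pow X \<I> (Suc n)) N))}"


section \<open>The \<open>p\<close>-adic integers\<close>

text \<open>The inverse limit of the rings \<open>\<int>/p^k\<close>, with residues represented in \<open>{0..<p^k}\<close>.\<close>

definition Zp :: "nat \<Rightarrow> (nat \<Rightarrow> int) ring" where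
  "Zp p =
     \<lparr>carrier = {\<alpha>. \<forall>k. 0 \<le> \<alpha> k \<and> \<alpha> k < int p ^ k \<and> \<alpha> (Suc k) mod int p ^ k = \<alpha> k},
      mult = (\<lambda>\<alpha> \<beta> k. (\<alpha> k * \<beta> k) mod int p ^ k),
      one = (\<lambda>k. 1 mod int p ^ k),
      zero = (\<lambda>k. 0),
      add = (\<lambda>\<alpha> \<beta> k. (\<alpha> k + \<beta> k) mod int p ^ k)\<rparr>"

definition Zp_of_int :: "nat \<Rightarrow> int \<Rightarrow> nat \<Rightarrow> int" where
  "Zp_of_int p a = (\<lambda>k. a mod int p ^ k)"

definition nu_infty ::
  "nat \<Rightarrow> nat \<Rightarrow> ('a, 'b) ringed_space \<Rightarrow> ('a, 'b, 'm) mod_sheaf \<Rightarrow> ('a set \<Rightarrow> 'm \<Rightarrow> 'm) \<Rightarrow>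
   ('a set \<Rightarrow> 'b set) \<Rightarrow> ('a set \<Rightarrow> 'm set) \<Rightarrow> (nat \<Rightarrow> int) set" where
  "nu_infty p q X M C \<I> N =
     {\<alpha> \<in> carrier (Zp p). \<forall>m\<ge>1. \<exists>n\<in>nu X M C \<I> m N.
        \<alpha> \<ominus>\<^bsub>Zp p\<^esub> Zp_of_int p (int n) \<in> PIdl\<^bsub>Zp p\<^esub> (Zp_of_int p (int (q ^ m)))}"

definition Z_localized :: "nat \<Rightarrow> rat set" where
  "Z_localized p = {r. \<not> int p dvd snd (quotient_of r)}"

text \<open>
  The image in \<open>Zp p\<close> of a set \<open>S\<close> of rational numbers: \<open>\<alpha>\<close> equals \<open>a/b\<close> iff \<open>b \<alpha> = a\<close>, because
  \<open>Zp p\<close> is torsion-free.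
\<close>

definition rats_in_Zp :: "nat \<Rightarrow> rat set \<Rightarrow> (nat \<Rightarrow> int) set" where
  "rats_in_Zp p S =
     {\<alpha> \<in> carrier (Zp p). \<exists>r\<in>S.
        Zp_of_int p (snd (quotient_of r)) \<otimes>\<^bsub>Zp p\<^esub> \<alpha> = Zp_of_int p (fst (quotient_of r))}"

end

theory Submission
  imports Defs "HOL-Number_Theory.Cong"
begin

text \<open>
  Write \<open>A m n = C^m(\<I>^n N)\<close>, so that \<open>\<nu>(q^m)\<close> is the set of jumps of the decreasing sequence
  \<open>A m 0, A m 1, \<dots>\<close>.  Since \<open>\<I>\<close> is locally generated by one element \<open>f\<close>, sections of \<open>A m n\<close> are
  locally of the form \<open>C^m(f^n y)\<close>, and moving powers of \<open>f\<close> through \<open>C\<close> gives three facts.  By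
  \<open>C^m(f^(n + q^m) y) = f C^m(f^n y)\<close>, jumps of \<open>A m\<close> remain jumps after reduction modulo \<open>q^m\<close>
  (\<open>power_image_translate\<close>); applying \<open>C\<close> creates no jumps (\<open>power_image_persist\<close>); and
  \<open>C^m(\<I>^n C^i(N)) = A (m + i) (q^i n)\<close> (\<open>power_image_cartier_image\<close>), so that
  \<open>C^i(N) = C^(i + j)(N)\<close> becomes \<open>A (m + i) (q^i n) = A (m + i + j) (q^(i + j) n)\<close>.  The rest of the
  argument is about such families \<open>A\<close> only.

  If \<open>\<alpha>\<close> is a limit of jumps, then by the first fact its residue modulo \<open>q^m\<close> is itself a jump of
  \<open>A m\<close>.  Dropping the \<open>i + j t\<close> lowest base \<open>q\<close> digits of \<open>\<alpha>\<close> leaves, modulo \<open>q^m\<close>, a number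
  \<open>k\<close> such that \<open>A (m + i)\<close> jumps in \<open>[q^i k, q^i (k + 1))\<close>, by the periodicity of \<open>A\<close>.  At most \<open>L\<close> numbers
  \<open>k < q^m\<close> have this property, whatever \<open>m\<close> is, so that two of the tails of \<open>\<alpha>\<close> agree
  (\<open>digits_eventually_periodic\<close>) and \<open>\<alpha>\<close> is rational.

  If \<open>N = C^j(N)\<close>, then \<open>i = 0\<close> is possible, and dropping \<open>j\<close> digits maps the jumps of
  \<open>A (m + j)\<close> below \<open>q^(m + j)\<close> onto those of \<open>A m\<close> below \<open>q^m\<close>.  The number of these jumps is bounded,
  so these maps are eventually bijective.  Hence limits of jumps with a common tail are
  equal.  This applies to \<open>\<alpha>\<close> and one of its own tails, and so the digits of \<open>\<alpha>\<close> are purely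
  periodic (\<open>digits_purely_periodic\<close>): with \<open>d\<close> the number whose \<open>v\<close> digits are the period, \<open>\<alpha> = d + q^v \<alpha>\<close>, which is \<open>- d / (q^v - 1) \<in> [-1, 0]\<close>.
\<close>

section \<open>Compatible residues and digit shifts\<close>

text \<open>
  A \<open>q\<close>-adic integer, encoded by its residues \<open>a m\<close> modulo \<open>q^m\<close>.
\<close>

definition coherent_residues :: "nat \<Rightarrow> (nat \<Rightarrow> nat) \<Rightarrow> bool" where
  "coherent_residues q a \<longleftrightarrow> (\<forall>m. a m < q ^ m \<and> a (Suc m) mod q ^ m = a m)"

text \<open>
  Removing the \<open>s\<close> lowest base \<open>q\<close> digits of a \<open>q\<close>-adic integer.
\<close>

definition drop_digits :: "nat \<Rightarrow> nat \<Rightarrow> (nat \<Rightarrow> nat) \<Rightarrow> nat \<Rightarrow> nat" where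
  "drop_digits q s a = (\<lambda>m. a (m + s) div q ^ s)"

lemma coherent_residues_mod:
  assumes "coherent_residues q a" "m \<le> n"
  shows "a n mod q ^ m = a m"
  using assms(2)
proof (induction n rule: dec_induct)
  case base
  then show ?case using assms(1) by (simp add: coherent_residues_def)
next
  case (step n)
  have "a (Suc n) mod q ^ m = a (Suc n) mod q ^ n mod q ^ m"
    using step.hyps by (simp add: mod_mod_cancel le_imp_power_dvd)
  also have "\<dots> = a n mod q ^ m"
    using assms(1) by (simp add: coherent_residues_def)
  finally show ?case using step.IH by simp
qed

lemma coherent_residues_drop_digits:
  assumes "coherent_residues q a" "q > 0"
  shows "coherent_residues q (drop_digits q s a)"
  unfolding coherent_residues_def
proof (intro allI conjI)
  fix m
  have "a (m + s) < q ^ m * q ^ s"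
    using assms(1) by (simp add: coherent_residues_def power_add [symmetric])
  then show "drop_digits q s a m < q ^ m"
    by (simp add: drop_digits_def less_mult_imp_div_less)
  have "a (Suc m + s) div q ^ s mod q ^ m = a (Suc m + s) mod q ^ (m + s) div q ^ s"
    using assms(2) by (simp add: mod_mult2_eq power_add mult.commute [of "q ^ m"])
  then show "drop_digits q s a (Suc m) mod q ^ m = drop_digits q s a m"
    using coherent_residues_mod [OF assms(1), of "m + s" "Suc m + s"]
    by (simp add: drop_digits_def)
qed

lemma drop_digits_drop_digits:
  "drop_digits q s (drop_digits q t a) = drop_digits q (s + t) a"
proof
  fix m
  have "a (m + s + t) div q ^ t div q ^ s = a (m + (s + t)) div (q ^ t * q ^ s)"
    by (simp only: div_mult2_eq add.assoc)
  then show "drop_digits q s (drop_digits q t a) m = drop_digits q (s + t) a m"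
    by (simp add: drop_digits_def power_add mult.commute)
qed

lemma coherent_residues_eqI:
  assumes "coherent_residues q a" "coherent_residues q b" "\<And>k. \<exists>m\<ge>k. a m = b m"
  shows "a = b"
proof
  fix k
  obtain m where "m \<ge> k" "a m = b m" using assms(3) by blast
  then show "a k = b k"
    using coherent_residues_mod [OF assms(1)] coherent_residues_mod [OF assms(2)] by metis
qed

text \<open>
  Two different sequences differ at all sufficiently high levels, so that the maximum over the
  finitely many pairs separates all of them.  The sum of the thresholds is used as an upper bound
  of this maximum.
\<close>

lemma finite_coherent_residues_separated:
  assumes "finite F" "\<And>a. a \<in> F \<Longrightarrow> coherent_residues q a"
  shows "\<exists>m\<ge>1. inj_on (\<lambda>a. a m) F"
proof -
  have "\<exists>m0. \<forall>m\<ge>m0. a m \<noteq> b m" if "a \<in> F" "b \<in> F" "a \<noteq> b" for a b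
    using coherent_residues_eqI [of q a b] assms(2) that by blast
  then obtain l where l: "\<And>a b m. a \<in> F \<Longrightarrow> b \<in> F \<Longrightarrow> a \<noteq> b \<Longrightarrow> m \<ge> l a b \<Longrightarrow> a m \<noteq> b m"
    by metis
  define m where "m = Suc (\<Sum>(a, b)\<in>F \<times> F. l a b)"
  have "m \<ge> l a b" if "a \<in> F" "b \<in> F" for a b
    using member_le_sum [of "(a, b)" "F \<times> F" "\<lambda>(a, b). l a b"] that assms(1)
    by (simp add: m_def)
  then have "inj_on (\<lambda>a. a m) F" using l by (fastforce simp: inj_on_def)
  then show ?thesis by (intro exI [of _ m]) (simp add: m_def)
qed

text \<open>
  Let \<open>\<alpha> = c + q^u \<beta>\<close> with \<open>c\<close> the lowest \<open>u\<close> digits.  The hypothesis says that \<open>\<beta>\<close> is its own tail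
  after \<open>v\<close> digits, so \<open>\<beta> = d + q^v \<beta>\<close>.  Eliminating \<open>\<beta>\<close> yields
  \<open>(q^v - 1) \<alpha> = (q^v - 1) c - q^u d\<close>, which is stated here at each finite level.
\<close>

lemma cong_of_drop_digits_eq:
  assumes "coherent_residues q a" "q > 0" "drop_digits q u a = drop_digits q (u + v) a"
  shows "[(int q ^ v - 1) * int (a m) =
    (int q ^ v - 1) * int (a u) - int q ^ u * int (drop_digits q u a v)] (mod int q ^ m)"
proof -
  define b where "b = drop_digits q u a"
  have b: "coherent_residues q b"
    unfolding b_def by (rule coherent_residues_drop_digits [OF assms(1,2)])
  have b_periodic: "drop_digits q v b = b"
    by (simp only: b_def drop_digits_drop_digits add.commute [of v u] assms(3) [symmetric])
  have split: "x (n + s) = x s + q ^ s * drop_digits q s x n"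
    if "coherent_residues q x" for x n s
    using coherent_residues_mod [OF that, of s "n + s"] mod_mult_div_eq [of "x (n + s)" "q ^ s"]
    by (simp add: drop_digits_def)
  have 1: "int (a (m + u)) = int (a u) + int q ^ u * int (b m)"
    using split [OF assms(1), of m u] by (simp add: b_def)
  have "b (m + v) = b v + q ^ v * b m" using split [OF b, of m v] b_periodic by simp
  then have 2: "int (a (m + v + u)) = int (a u) + int q ^ u * (int (b v) + int q ^ v * int (b m))"
    using split [OF assms(1), of "m + v" u] by (simp add: b_def)
  have cong_a: "[int (a (m + k)) = int (a m)] (mod int q ^ m)" for k
  proof -
    have "a (m + k) mod q ^ m = a m mod q ^ m"
      using coherent_residues_mod [OF assms(1), of m "m + k"]
        coherent_residues_mod [OF assms(1), of m m] by simp
    then show ?thesis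
      by (metis cong_def cong_int_iff of_nat_power)
  qed
  have "[int q ^ v * int (a m) - int (a m) =
      int q ^ v * int (a (m + u)) - int (a (m + v + u))] (mod int q ^ m)"
    using cong_a [of u] cong_a [of "v + u"]
    by (intro cong_diff cong_mult) (auto simp: cong_sym_eq add.assoc)
  also have "int q ^ v * int (a (m + u)) - int (a (m + v + u)) =
      (int q ^ v - 1) * int (a u) - int q ^ u * int (b v)"
    unfolding 1 2 by (simp add: algebra_simps)
  finally show ?thesis by (simp add: b_def algebra_simps)
qed

section \<open>Jumps of a filtration that scales by powers of q\<close>

text \<open>
  The properties of \<open>A m n = C^m(\<I>^n N)\<close> that control its jumps.
\<close>

locale q_adic_filtration =
  fixes q :: nat and A :: "nat \<Rightarrow> nat \<Rightarrow> 'x::order"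
  assumes q: "q > 1"
    and antitone: "A m (Suc n) \<le> A m n"
    and translate: "A m n = A m (Suc n) \<Longrightarrow> A m (n + q ^ m) = A m (Suc n + q ^ m)"
    and persist: "A m n = A m (Suc n) \<Longrightarrow> A (Suc m) n = A (Suc m) (Suc n)"
begin

definition jumps :: "nat \<Rightarrow> nat set" where
  "jumps m = {n. A m n \<noteq> A m (Suc n)}"

lemma antitone_le: "a \<le> b \<Longrightarrow> A m b \<le> A m a"
  by (induction b rule: dec_induct) (auto intro: order.trans [OF antitone])

lemma neq_iff_jump_between:
  assumes "a \<le> b"
  shows "A m a \<noteq> A m b \<longleftrightarrow> (\<exists>n\<in>jumps m. a \<le> n \<and> n < b)"
proof
  assume "A m a \<noteq> A m b"
  with assms show "\<exists>n\<in>jumps m. a \<le> n \<and> n < b"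
  proof (induction b rule: dec_induct)
    case (step b)
    then show ?case by (cases "A m a = A m b") (auto simp: jumps_def intro: less_SucI)
  qed simp
next
  assume "\<exists>n\<in>jumps m. a \<le> n \<and> n < b"
  then obtain n where n: "A m n \<noteq> A m (Suc n)" "a \<le> n" "Suc n \<le> b"
    by (auto simp: jumps_def)
  \<comment> \<open>If the end terms agreed, antitonicity would squeeze all terms between them.\<close>
  show "A m a \<noteq> A m b"
  proof
    assume "A m a = A m b"
    then have "A m n \<le> A m (Suc n)"
      using antitone_le [OF n(2), of m] antitone_le [OF n(3), of m] by simp
    then show False using antitone [of m n] n(1) by simp
  qed
qed

lemma mod_in_jumps:
  assumes "n \<in> jumps m"
  shows "n mod q ^ m \<in> jumps m"
  using assms
proof (induction n rule: less_induct)
  case (less n)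
  show ?case
  proof (cases "n < q ^ m")
    case False
    moreover have "0 < q ^ m" using q by simp
    ultimately have n: "n = (n - q ^ m) + q ^ m" "n - q ^ m < n"
      by linarith+
    have "n - q ^ m \<in> jumps m"
      using less.prems translate [of m "n - q ^ m"] n(1) by (auto simp: jumps_def)
    then have "(n - q ^ m) mod q ^ m \<in> jumps m" using less.IH n(2) by blast
    then show ?thesis using n(1) by (metis mod_add_self2)
  qed (use less.prems in simp)
qed

text \<open>
  For \<open>A m n = C^m(\<I>^n N)\<close>, this is the set of jumps of the filtration that belongs to \<open>C^i(N)\<close>.
\<close>

definition jump_blocks :: "nat \<Rightarrow> nat \<Rightarrow> nat set" where
  "jump_blocks i m = (\<lambda>n. n div q ^ i) ` jumps (m + i)"

lemma mem_jump_blocks_iff: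
  "k \<in> jump_blocks i m \<longleftrightarrow> A (m + i) (q ^ i * k) \<noteq> A (m + i) (q ^ i * Suc k)"
proof -
  have block: "n div q ^ i = k \<longleftrightarrow> q ^ i * k \<le> n \<and> n < q ^ i * Suc k" for n
    using q by (auto simp: div_nat_eqI mult.commute times_div_less_eq_dividend dividend_less_times_div)
  have "k \<in> jump_blocks i m \<longleftrightarrow> (\<exists>n\<in>jumps (m + i). n div q ^ i = k)"
    by (auto simp: jump_blocks_def)
  also have "\<dots> \<longleftrightarrow> A (m + i) (q ^ i * k) \<noteq> A (m + i) (q ^ i * Suc k)"
    unfolding block by (rule neq_iff_jump_between [symmetric]) simp
  finally show ?thesis .
qed

lemma jump_blocks_add:
  "jump_blocks (i + s) m = (\<lambda>k. k div q ^ s) ` jump_blocks i (m + s)"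
  by (simp add: jump_blocks_def image_image power_add div_mult2_eq ac_simps)

lemma jump_blocks_0: "jump_blocks 0 m = jumps m"
  by (simp add: jump_blocks_def)

definition low_jumps :: "nat \<Rightarrow> nat set" where
  "low_jumps m = jumps m \<inter> {0..<q ^ m}"

lemma finite_low_jumps: "finite (low_jumps m)"
  by (simp add: low_jumps_def)

lemma low_jump_blocks: 
  "jump_blocks i m \<inter> {0..<q ^ m} = (\<lambda>n. n div q ^ i) ` low_jumps (m + i)"
  using q by (auto simp: jump_blocks_def low_jumps_def power_add div_less_iff_less_mult)

end

section \<open>Periodicity of the digits of a limit of jumps\<close>

locale preperiodic_filtration = q_adic_filtration +
  fixes i j K :: nat
  assumes j: "j > 0"
    and preperiodic: "A (m + i) (q ^ i * n) = A (m + i + j) (q ^ (i + j) * n)"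
    and bounded: "m \<ge> 1 \<Longrightarrow> card (low_jumps m) \<le> K"
begin

lemma jump_blocks_period: "jump_blocks (i + j * t) m = jump_blocks i m"
proof (induction t arbitrary: m)
  case (Suc t)
  have step: "jump_blocks (i + j) m = jump_blocks i m" for m
    by (auto simp only: mem_jump_blocks_iff preperiodic add.assoc)
  have "jump_blocks (i + j * Suc t) m = jump_blocks ((i + j) + j * t) m"
    by (simp add: algebra_simps)
  also have "\<dots> = jump_blocks (i + j * t) m"
    by (simp add: jump_blocks_add [where s = "j * t"] step)
  finally show ?case by (simp add: Suc.IH)
qed simp

lemma drop_digits_in_jump_blocks:
  assumes "\<And>m. m \<ge> 1 \<Longrightarrow> a m \<in> jumps m" "m \<ge> 1"
  shows "drop_digits q (i + j * t) a m \<in> jump_blocks i m"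
proof -
  have "a (m + (i + j * t)) \<in> jumps (m + (i + j * t))" using assms by simp
  then have "drop_digits q (i + j * t) a m \<in> jump_blocks (i + j * t) m"
    by (auto simp: jump_blocks_def drop_digits_def)
  then show ?thesis by (simp add: jump_blocks_period)
qed

text \<open>
  Otherwise \<open>K + 1\<close> tails of \<open>\<alpha>\<close> would be distinct already modulo some \<open>q^m\<close>.  Their residues are jump
  blocks below \<open>q^m\<close>, each of which contains a jump below \<open>q^(m + i)\<close>, and there are at most \<open>K\<close> of these.
\<close>

lemma digits_eventually_periodic:
  assumes "coherent_residues q a" "\<And>m. m \<ge> 1 \<Longrightarrow> a m \<in> jumps m"
  shows "\<exists>s t. s < t \<and> drop_digits q (i + j * s) a = drop_digits q (i + j * t) a"
proof (rule ccontr)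
  assume "\<not> ?thesis"
  then have inj: "inj_on (\<lambda>t. drop_digits q (i + j * t) a) {0..K}"
    by (auto intro: linorder_inj_onI)
  define F where "F = (\<lambda>t. drop_digits q (i + j * t) a) ` {0..K}"
  have F: "finite F" "card F = Suc K" and coh: "\<And>b. b \<in> F \<Longrightarrow> coherent_residues q b"
    using card_image [OF inj] coherent_residues_drop_digits [OF assms(1)] q
    by (auto simp: F_def)
  obtain m where m: "m \<ge> 1" "inj_on (\<lambda>b. b m) F"
    using finite_coherent_residues_separated [OF F(1) coh] by blast
  have "(\<lambda>b. b m) ` F \<subseteq> (\<lambda>n. n div q ^ i) ` low_jumps (m + i)"
    unfolding low_jump_blocks [symmetric]
    using coh drop_digits_in_jump_blocks [OF assms(2) m(1)]
    by (auto simp: F_def coherent_residues_def)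
  then have "Suc K \<le> card ((\<lambda>n. n div q ^ i) ` low_jumps (m + i))"
    using card_mono card_image [OF m(2)] F(2) finite_low_jumps by (metis finite_imageI)
  also have "\<dots> \<le> card (low_jumps (m + i))" by (rule card_image_le [OF finite_low_jumps])
  also have "\<dots> \<le> K" using bounded m(1) by simp
  finally show False by simp
qed

text \<open>
  For \<open>i = 0\<close> the low jumps at level \<open>m + j t\<close> map onto those at level \<open>m\<close>.  From the level \<open>m0\<close> with the
  most low jumps on, in steps of \<open>j\<close>, these maps between finite sets of equal size are injective.  So
  \<open>\<alpha>\<close> and its tail \<open>b\<close> are equal as soon as they agree after dropping further digits.
\<close>

lemma digits_purely_periodic:
  assumes "i = 0" "coherent_residues q a" "\<And>m. m \<ge> 1 \<Longrightarrow> a m \<in> jumps m"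
  shows "\<exists>v>0. drop_digits q v a = a"
proof -
  have onto: "(\<lambda>n. n div q ^ (j * t)) ` low_jumps (m + j * t) = low_jumps m" for t m
    using low_jump_blocks [of "j * t" m] jump_blocks_period [of t m] assms(1)
    by (simp add: jump_blocks_0 low_jumps_def)
  obtain m0 where m0: "m0 \<ge> 1" "\<And>m. m \<ge> 1 \<Longrightarrow> card (low_jumps m) \<le> card (low_jumps m0)"
    using ex_has_greatest_nat [of "\<lambda>m. m \<ge> 1" 1 "\<lambda>m. card (low_jumps m)" "Suc K"] bounded
    by (metis le_imp_less_Suc order_refl)
  have inj: "inj_on (\<lambda>n. n div q ^ (j * t)) (low_jumps (m0 + j * s + j * t))" for s t
  proof (rule eq_card_imp_inj_on [OF finite_low_jumps])
    have "card (low_jumps m0) \<le> card (low_jumps (m0 + j * s))"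
      using onto [of s m0] card_image_le [OF finite_low_jumps] by metis
    then have "card (low_jumps (m0 + j * s + j * t)) \<le> card (low_jumps (m0 + j * s))"
      using m0(2) [of "m0 + j * s + j * t"] m0(1) by simp
    then show "card ((\<lambda>n. n div q ^ (j * t)) ` low_jumps (m0 + j * s + j * t)) =
        card (low_jumps (m0 + j * s + j * t))"
      using card_image_le [OF finite_low_jumps, of "\<lambda>n. n div q ^ (j * t)" "m0 + j * s + j * t"]
      by (simp add: onto)
  qed
  obtain s t where st: "s < t" "drop_digits q (j * s) a = drop_digits q (j * t) a"
    using digits_eventually_periodic [OF assms(2,3)] assms(1) by auto
  define b where "b = drop_digits q (j * (t - s)) a"
  have b: "coherent_residues q b"
    using coherent_residues_drop_digits [OF assms(2)] q by (simp add: b_def)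
  have b_jump: "b m \<in> jumps m" if "m \<ge> 1" for m
    using drop_digits_in_jump_blocks [OF assms(3) that, of "t - s"] assms(1)
    by (simp add: b_def jump_blocks_0)
  have "drop_digits q (j * s) b = drop_digits q (j * s) a"
    using st by (simp add: b_def drop_digits_drop_digits add_mult_distrib2 [symmetric])
  then have eq: "b (m + j * s) div q ^ (j * s) = a (m + j * s) div q ^ (j * s)" for m
    by (simp add: drop_digits_def fun_eq_iff)
  have "b = a"
  proof (rule coherent_residues_eqI [OF b assms(2)])
    fix k
    have low: "b (m0 + j * k + j * s) \<in> low_jumps (m0 + j * k + j * s)"
      "a (m0 + j * k + j * s) \<in> low_jumps (m0 + j * k + j * s)"
      using b_jump assms(3) b assms(2) m0(1) by (auto simp: low_jumps_def coherent_residues_def)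
    have "b (m0 + j * k + j * s) = a (m0 + j * k + j * s)"
      using inj_onD [OF inj eq low] .
    moreover have "k \<le> m0 + j * k + j * s" using j by (simp add: trans_le_add1 trans_le_add2)
    ultimately show "\<exists>m\<ge>k. b m = a m" by blast
  qed
  then show ?thesis using st(1) j by (intro exI [of _ "j * (t - s)"]) (simp add: b_def)
qed

end

section \<open>From periodic digits to rational p-adic integers\<close>

lemma mod_power_Suc_mod_power: "a mod int p ^ Suc k mod int p ^ k = a mod int p ^ k"
  by (simp add: mod_mod_cancel)

lemma abelian_group_Zp:
  assumes "p > 0"
  shows "abelian_group (Zp p)"
proof (rule abelian_groupI)
  show "\<alpha> \<oplus>\<^bsub>Zp p\<^esub> \<beta> \<in> carrier (Zp p)"
    if "\<alpha> \<in> carrier (Zp p)" "\<beta> \<in> carrier (Zp p)" for \<alpha> \<beta>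
  proof -
    have "(\<alpha> (Suc k) + \<beta> (Suc k)) mod int p ^ k = (\<alpha> k + \<beta> k) mod int p ^ k" for k
      using that mod_add_eq [of "\<alpha> (Suc k)" "int p ^ k" "\<beta> (Suc k)"] by (simp add: Zp_def)
    then show ?thesis
      using assms by (simp add: Zp_def mod_power_Suc_mod_power del: power_Suc)
  qed
  show "\<exists>\<beta>\<in>carrier (Zp p). \<beta> \<oplus>\<^bsub>Zp p\<^esub> \<alpha> = \<zero>\<^bsub>Zp p\<^esub>"
    if "\<alpha> \<in> carrier (Zp p)" for \<alpha>
  proof
    have "(- \<alpha> (Suc k)) mod int p ^ k = (- \<alpha> k) mod int p ^ k" for k
      using that mod_minus_eq [of "\<alpha> (Suc k)" "int p ^ k"] by (simp add: Zp_def)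
    then show "(\<lambda>k. (- \<alpha> k) mod int p ^ k) \<in> carrier (Zp p)"
      using assms by (simp add: Zp_def mod_power_Suc_mod_power del: power_Suc)
    show "(\<lambda>k. (- \<alpha> k) mod int p ^ k) \<oplus>\<^bsub>Zp p\<^esub> \<alpha> = \<zero>\<^bsub>Zp p\<^esub>"
      by (simp add: Zp_def mod_add_left_eq)
  qed
qed (use assms in \<open>auto simp: Zp_def mod_simps ac_simps fun_eq_iff\<close>)

lemma Zp_of_int_closed:
  assumes "p > 0"
  shows "Zp_of_int p a \<in> carrier (Zp p)"
  using assms by (simp add: Zp_def Zp_of_int_def mod_power_Suc_mod_power del: power_Suc)

lemma Zp_residue_mod:
  assumes "\<alpha> \<in> carrier (Zp p)" "k \<le> n"
  shows "\<alpha> n mod int p ^ k = \<alpha> k"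
  using assms(2)
proof (induction n rule: dec_induct)
  case base
  then show ?case using assms(1) by (simp add: Zp_def)
next
  case (step n)
  have "\<alpha> (Suc n) mod int p ^ k = \<alpha> (Suc n) mod int p ^ n mod int p ^ k"
    using step.hyps by (simp add: mod_mod_cancel le_imp_power_dvd)
  then show ?case using assms(1) step.IH by (simp add: Zp_def)
qed

text \<open>
  The subtraction in \<open>Zp p\<close> is defined through inverses in its additive group, so that the congruence
  has to be extracted from \<open>(\<alpha> - n) + n = \<alpha>\<close>.
\<close>

lemma Zp_residue_of_diff_in_PIdl:
  assumes "p > 0" "\<alpha> \<in> carrier (Zp p)"
    and "\<alpha> \<ominus>\<^bsub>Zp p\<^esub> Zp_of_int p n \<in> PIdl\<^bsub>Zp p\<^esub> (Zp_of_int p (int p ^ k))"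
  shows "\<alpha> k = n mod int p ^ k"
proof -
  interpret Z: abelian_group "Zp p" by (rule abelian_group_Zp [OF assms(1)])
  define \<delta> where "\<delta> = \<alpha> \<ominus>\<^bsub>Zp p\<^esub> Zp_of_int p n"
  have n: "Zp_of_int p n \<in> carrier (Zp p)" by (rule Zp_of_int_closed [OF assms(1)])
  have "\<delta> \<oplus>\<^bsub>Zp p\<^esub> Zp_of_int p n = \<alpha>"
    using assms(2) n by (simp add: \<delta>_def a_minus_def Z.a_assoc Z.l_neg)
  then have "\<alpha> k = (\<delta> k + n mod int p ^ k) mod int p ^ k"
    by (auto simp: Zp_def Zp_of_int_def)
  moreover have "\<delta> k = 0"
    using assms(3) by (auto simp: \<delta>_def cgenideal_def Zp_def Zp_of_int_def)
  ultimately show ?thesis by simp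
qed

text \<open>
  Membership in \<open>rats_in_Zp\<close> refers to reduced fractions.  The common factor \<open>g\<close> can be cancelled because
  it divides \<open>y\<close> and is therefore invertible modulo powers of \<open>p\<close>.  Congruences modulo the powers of
  \<open>p^e\<close> suffice, as these are cofinal among the powers of \<open>p\<close>.
\<close>

lemma in_rats_in_Zp:
  fixes x y :: int
  assumes "p > 1" "\<alpha> \<in> carrier (Zp p)" "y > 0" "coprime y (int p)" "Fract x y \<in> S" "e > 0"
    and cong: "\<And>m. [y * \<alpha> (e * m) = x] (mod int p ^ (e * m))"
  shows "\<alpha> \<in> rats_in_Zp p (Z_localized p \<inter> S)"
proof -
  obtain x' y' where r: "quotient_of (Fract x y) = (x', y')" by fastforce
  define g where "g = gcd x y"
  have xy': "x = g * x'" "y = g * y'" "g \<noteq> 0"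
    using r assms(3) by (auto simp: quotient_of_Fract normalize_def g_def Let_def)
  have cop: "coprime g (int p)" "coprime y' (int p)"
    using assms(4) xy'(2) by simp_all
  have "\<not> int p dvd y'"
    using cop(2) assms(1) not_coprimeI [of "int p" y' "int p"] by auto
  then have mem: "Fract x y \<in> Z_localized p \<inter> S"
    using assms(5) r by (simp add: Z_localized_def)
  have "(y' * \<alpha> k) mod int p ^ k = x' mod int p ^ k" for k
  proof -
    have k: "k \<le> e * k" using assms(6) by simp
    have "[y * \<alpha> (e * k) = x] (mod int p ^ k)"
      using cong_dvd_modulus [OF cong [of k] le_imp_power_dvd [OF k]] .
    moreover have "[\<alpha> (e * k) = \<alpha> k] (mod int p ^ k)"
      using Zp_residue_mod [OF assms(2) k] Zp_residue_mod [OF assms(2), of k k]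
      by (simp add: cong_def)
    ultimately have "[y * \<alpha> k = x] (mod int p ^ k)"
      by (metis cong_scalar_left cong_sym cong_trans)
    then have "[g * (y' * \<alpha> k) = g * x'] (mod int p ^ k)"
      by (simp add: xy'(1,2) mult.assoc)
    then have "[y' * \<alpha> k = x'] (mod int p ^ k)"
      using cop(1) by (subst (asm) cong_mult_lcancel) simp_all
    then show ?thesis by (simp add: cong_def)
  qed
  then have "Zp_of_int p y' \<otimes>\<^bsub>Zp p\<^esub> \<alpha> = Zp_of_int p x'"
    by (simp add: Zp_def Zp_of_int_def mod_mult_left_eq)
  then show ?thesis
    using assms(2) mem r by (auto simp: rats_in_Zp_def intro!: bexI [of _ "Fract x y"])
qed

text \<open>
  In the purely periodic case the pre-period is empty, and \<open>\<alpha> = - d / (q^v - 1)\<close> with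
  \<open>0 \<le> d < q^v\<close>, which lies in \<open>[-1, 0]\<close>.
\<close>

lemma (in preperiodic_filtration) jump_limits_rational:
  assumes "p > 1" "q = p ^ e" "e > 0" "\<alpha> \<in> carrier (Zp p)"
    and limit: "\<And>m. m \<ge> 1 \<Longrightarrow> \<exists>n\<in>jumps m. \<alpha> (e * m) = int n mod int (q ^ m)"
  shows "\<alpha> \<in> rats_in_Zp p (Z_localized p)"
    and "i = 0 \<Longrightarrow> \<alpha> \<in> rats_in_Zp p (Z_localized p \<inter> {-1..0})"
proof -
  define a where "a m = nat (\<alpha> (e * m))" for m
  have q_pow: "int p ^ (e * m) = int q ^ m" for m by (simp add: assms(2) power_mult)
  have \<alpha>_eq: "\<alpha> (e * m) = int (a m)" for m using assms(4) by (simp add: a_def Zp_def)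
  have coh: "coherent_residues q a"
    unfolding coherent_residues_def
  proof (intro allI conjI)
    fix m
    have "int (a m) < int q ^ m"
      using assms(4) by (simp add: \<alpha>_eq [symmetric] q_pow [symmetric] Zp_def)
    then show "a m < q ^ m" by (simp flip: of_nat_power)
    have "int (a (Suc m)) mod int q ^ m = int (a m)"
      unfolding \<alpha>_eq [symmetric] q_pow [symmetric]
      by (rule Zp_residue_mod [OF assms(4)]) simp
    then show "a (Suc m) mod q ^ m = a m" by (simp flip: of_nat_power of_nat_mod)
  qed
  have jump: "a m \<in> jumps m" if m: "m \<ge> 1" for m
  proof -
    obtain n where "n \<in> jumps m" "int (a m) = int n mod int (q ^ m)"
      using limit [OF m] unfolding \<alpha>_eq by blast
    then have "a m = n mod q ^ m" by (simp only: zmod_int [symmetric] of_nat_eq_iff)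
    with mod_in_jumps [OF \<open>n \<in> jumps m\<close>] show ?thesis by simp
  qed
  have rational: "\<alpha> \<in> rats_in_Zp p (Z_localized p \<inter> S)"
    if "v > 0" "drop_digits q u a = drop_digits q (u + v) a"
      "Fract ((int q ^ v - 1) * int (a u) - int q ^ u * int (drop_digits q u a v)) (int q ^ v - 1) \<in> S"
    for u v S
  proof (rule in_rats_in_Zp [OF assms(1,4) _ _ that(3) assms(3)])
    show "int q ^ v - 1 > 0" using q that(1) by simp
    have "coprime (int q ^ v - 1) (int p ^ (e * v))"
      unfolding q_pow by (rule coprime_diff_one_left)
    then show "coprime (int q ^ v - 1) (int p)"
      using that(1) assms(3) by simp
    show "[(int q ^ v - 1) * \<alpha> (e * m) =
        (int q ^ v - 1) * int (a u) - int q ^ u * int (drop_digits q u a v)] (mod int p ^ (e * m))" for m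
      unfolding \<alpha>_eq q_pow using cong_of_drop_digits_eq [OF coh _ that(2)] q by simp
  qed
  obtain s t where st: "s < t" "drop_digits q (i + j * s) a = drop_digits q (i + j * t) a"
    using digits_eventually_periodic [OF coh jump] by blast
  have t_eq: "i + j * t = (i + j * s) + j * (t - s)"
    using st(1) by (simp add: add_mult_distrib2 [symmetric])
  have period: "drop_digits q (i + j * s) a = drop_digits q ((i + j * s) + j * (t - s)) a"
    using st(2) unfolding t_eq .
  have "j * (t - s) > 0" using st(1) j by simp
  from rational [OF this period UNIV_I]
  show "\<alpha> \<in> rats_in_Zp p (Z_localized p)" by (simp only: Int_UNIV_right)
  assume "i = 0"
  then obtain v where v: "v > 0" "drop_digits q v a = a"
    using digits_purely_periodic [OF _ coh jump] by blast
  have a0: "a 0 = 0" and av: "a v < q ^ v"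
    using coh by (auto simp: coherent_residues_def dest: spec [of _ 0])
  have drop0: "drop_digits q 0 a = a" by (simp add: drop_digits_def)
  have pos: "(0::rat) < of_nat q ^ v - 1" using q v(1) by simp
  have "int (a v) \<le> int q ^ v - 1" using av by (simp flip: of_nat_power)
  then have "(of_int (int (a v)) :: rat) \<le> of_int (int q ^ v - 1)"
    by (simp only: of_int_le_iff)
  then have "(of_nat (a v) :: rat) / (of_nat q ^ v - 1) \<in> {0..1}"
    using pos by (simp add: divide_le_eq_1)
  then have "Fract (- int (a v)) (int q ^ v - 1) \<in> {-1..0}"
    by (simp add: Fract_of_int_quotient)
  moreover have "drop_digits q 0 a = drop_digits q (0 + v) a"
    using v(2) drop0 by simp
  ultimately show "\<alpha> \<in> rats_in_Zp p (Z_localized p \<inter> {-1..0})"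
    by (intro rational [OF v(1), of 0]) (simp_all only: drop0 a0 of_nat_0 mult_zero_right
        power_0 mult_1 diff_0)
qed

section \<open>Subsheaves given by local conditions\<close>

lemma locally_on_self: "openin T U \<Longrightarrow> Q U \<Longrightarrow> locally_on T U Q"
  by (auto simp: locally_on_def)

lemma locally_on_bind:
  assumes "locally_on T U Q"
    and "\<And>V. openin T V \<Longrightarrow> V \<subseteq> U \<Longrightarrow> Q V \<Longrightarrow> locally_on T V R"
  shows "locally_on T U R"
  unfolding locally_on_def
proof
  fix x assume "x \<in> U"
  then obtain V where V: "openin T V" "x \<in> V" "V \<subseteq> U" "Q V"
    using assms(1) by (auto simp: locally_on_def)
  then obtain W where "openin T W" "x \<in> W" "W \<subseteq> V" "R W"
    using assms(2) [of V] by (auto simp: locally_on_def)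
  then show "\<exists>V. openin T V \<and> x \<in> V \<and> V \<subseteq> U \<and> R V" using V(3) by blast
qed

lemma set_sheaf_closed:
  "set_sheaf T F r \<Longrightarrow> openin T U \<Longrightarrow> openin T V \<Longrightarrow> V \<subseteq> U \<Longrightarrow> x \<in> F U \<Longrightarrow> r U V x \<in> F V"
  by (auto simp: set_sheaf_def Pi_iff)

lemma set_sheaf_self: "set_sheaf T F r \<Longrightarrow> openin T U \<Longrightarrow> x \<in> F U \<Longrightarrow> r U U x = x"
  by (simp add: set_sheaf_def)

lemma set_sheaf_comp:
  "set_sheaf T F r \<Longrightarrow> openin T U \<Longrightarrow> openin T V \<Longrightarrow> openin T W \<Longrightarrow> W \<subseteq> V \<Longrightarrow> V \<subseteq> U \<Longrightarrow>
   x \<in> F U \<Longrightarrow> r V W (r U V x) = r U W x"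
  by (simp add: set_sheaf_def)

text \<open>
  The subsheaf of \<open>M\<close> generated by a family of sets of sections.  Products with ideals and images under
  \<open>C\<close> both have this form, so that identities between them can be checked on local representatives.
\<close>

definition sheafify ::
  "('a, 'b) ringed_space \<Rightarrow> ('a, 'b, 'm) mod_sheaf \<Rightarrow> ('a set \<Rightarrow> 'm set) \<Rightarrow> 'a set \<Rightarrow> 'm set" where
  "sheafify X M A U =
     {x \<in> carrier (msec M U). locally_on (pts X) U (\<lambda>V. mres M U V x \<in> A V)}"

text \<open>
  The generators from the definition of a locally principal ideal sheaf.  All of them are admitted,
  not one for each member of a cover, so that the family is closed under restriction.
\<close>

definition local_generators ::
  "('a, 'b) ringed_space \<Rightarrow> ('a set \<Rightarrow> 'b set) \<Rightarrow> 'a set \<Rightarrow> 'b set" where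
  "local_generators X \<I> U =
     {f \<in> \<I> U. \<forall>V. openin (pts X) V \<and> V \<subseteq> U \<longrightarrow>
        (\<forall>s\<in>\<I> V. locally_on (pts X) V
           (\<lambda>W. \<exists>a\<in>carrier (sec X W). res X V W s = a \<otimes>\<^bsub>sec X W\<^esub> res X U W f))}"

text \<open>
  Local representatives of \<open>\<I>^n K\<close>.  No sums are needed, because two multiples of powers of local
  generators can be rewritten with the same generator; see \<open>pw_add\<close>.
\<close>

definition power_multiples ::
  "('a, 'b) ringed_space \<Rightarrow> ('a, 'b, 'm) mod_sheaf \<Rightarrow> ('a set \<Rightarrow> 'b set) \<Rightarrow> nat \<Rightarrow>
   ('a set \<Rightarrow> 'm set) \<Rightarrow> 'a set \<Rightarrow> 'm set" where
  "power_multiples X M \<I> n K V =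
     {(f [^]\<^bsub>sec X V\<^esub> n) \<odot>\<^bsub>msec M V\<^esub> y | f y. f \<in> local_generators X \<I> V \<and> y \<in> K V}"

locale sheaf_of_modules =
  fixes X :: "('a, 'b) ringed_space" and M :: "('a, 'b, 'm) mod_sheaf"
  assumes ringed: "is_ringed_space X" and modules: "is_mod_sheaf X M"
begin

abbreviation "opn \<equiv> openin (pts X)"

lemma ring_sec: "opn U \<Longrightarrow> cring (sec X U)"
  using ringed by (simp add: is_ringed_space_def)

lemma module_msec: "opn U \<Longrightarrow> module (sec X U) (msec M U)"
  using modules by (simp add: is_mod_sheaf_def)

lemma res_hom: "opn U \<Longrightarrow> opn V \<Longrightarrow> V \<subseteq> U \<Longrightarrow> res X U V \<in> ring_hom (sec X U) (sec X V)"
  using ringed by (simp add: is_ringed_space_def)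

lemma res_sheaf: "set_sheaf (pts X) (\<lambda>U. carrier (sec X U)) (res X)"
  using ringed by (simp add: is_ringed_space_def)

lemma mres_sheaf: "set_sheaf (pts X) (\<lambda>U. carrier (msec M U)) (mres M)"
  using modules by (simp add: is_mod_sheaf_def)

lemma res_closed:
  "opn U \<Longrightarrow> opn V \<Longrightarrow> V \<subseteq> U \<Longrightarrow> a \<in> carrier (sec X U) \<Longrightarrow> res X U V a \<in> carrier (sec X V)"
  by (rule ring_hom_closed [OF res_hom])

lemma res_res:
  "opn U \<Longrightarrow> opn V \<Longrightarrow> opn W \<Longrightarrow> W \<subseteq> V \<Longrightarrow> V \<subseteq> U \<Longrightarrow> a \<in> carrier (sec X U) \<Longrightarrow>
   res X V W (res X U V a) = res X U W a"
  by (rule set_sheaf_comp [OF res_sheaf])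

lemma res_self: "opn U \<Longrightarrow> a \<in> carrier (sec X U) \<Longrightarrow> res X U U a = a"
  by (rule set_sheaf_self [OF res_sheaf])

lemma res_mult:
  "opn U \<Longrightarrow> opn V \<Longrightarrow> V \<subseteq> U \<Longrightarrow> a \<in> carrier (sec X U) \<Longrightarrow> b \<in> carrier (sec X U) \<Longrightarrow>
   res X U V (a \<otimes>\<^bsub>sec X U\<^esub> b) = res X U V a \<otimes>\<^bsub>sec X V\<^esub> res X U V b"
  by (rule ring_hom_mult [OF res_hom])

lemma res_power:
  assumes "opn U" "opn V" "V \<subseteq> U" "a \<in> carrier (sec X U)"
  shows "res X U V (a [^]\<^bsub>sec X U\<^esub> (n::nat)) = res X U V a [^]\<^bsub>sec X V\<^esub> n"
proof -
  interpret U: cring "sec X U" by (rule ring_sec [OF assms(1)])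
  interpret V: cring "sec X V" by (rule ring_sec [OF assms(2)])
  interpret ring_hom_cring "sec X U" "sec X V" "res X U V"
    using res_hom [OF assms(1-3)] by unfold_locales
  show ?thesis using hom_pow [OF assms(4)] by simp
qed

lemma mres_closed:
  "opn U \<Longrightarrow> opn V \<Longrightarrow> V \<subseteq> U \<Longrightarrow> x \<in> carrier (msec M U) \<Longrightarrow> mres M U V x \<in> carrier (msec M V)"
  by (rule set_sheaf_closed [OF mres_sheaf])

lemma mres_mres:
  "opn U \<Longrightarrow> opn V \<Longrightarrow> opn W \<Longrightarrow> W \<subseteq> V \<Longrightarrow> V \<subseteq> U \<Longrightarrow> x \<in> carrier (msec M U) \<Longrightarrow>
   mres M V W (mres M U V x) = mres M U W x"
  by (rule set_sheaf_comp [OF mres_sheaf])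

lemma mres_self: "opn U \<Longrightarrow> x \<in> carrier (msec M U) \<Longrightarrow> mres M U U x = x"
  by (rule set_sheaf_self [OF mres_sheaf])

lemma mres_smult:
  "opn U \<Longrightarrow> opn V \<Longrightarrow> V \<subseteq> U \<Longrightarrow> a \<in> carrier (sec X U) \<Longrightarrow> x \<in> carrier (msec M U) \<Longrightarrow>
   mres M U V (a \<odot>\<^bsub>msec M U\<^esub> x) = res X U V a \<odot>\<^bsub>msec M V\<^esub> mres M U V x"
  using modules by (simp add: is_mod_sheaf_def)

lemma mres_add:
  assumes "opn U" "opn V" "V \<subseteq> U" "x \<in> carrier (msec M U)" "y \<in> carrier (msec M U)"
  shows "mres M U V (x \<oplus>\<^bsub>msec M U\<^esub> y) = mres M U V x \<oplus>\<^bsub>msec M V\<^esub> mres M U V y"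
proof -
  have "mres M U V \<in> hom (add_monoid (msec M U)) (add_monoid (msec M V))"
    using modules assms(1-3) by (simp add: is_mod_sheaf_def)
  from hom_mult [OF this] show ?thesis using assms(4,5) by simp
qed

lemma smult_closed:
  "opn U \<Longrightarrow> a \<in> carrier (sec X U) \<Longrightarrow> x \<in> carrier (msec M U) \<Longrightarrow>
   a \<odot>\<^bsub>msec M U\<^esub> x \<in> carrier (msec M U)"
  by (rule module.smult_closed [OF module_msec])

lemma power_closed:
  assumes "opn U" "a \<in> carrier (sec X U)"
  shows "a [^]\<^bsub>sec X U\<^esub> (n::nat) \<in> carrier (sec X U)"
proof -
  interpret cring "sec X U" by (rule ring_sec [OF assms(1)])
  show ?thesis using assms(2) by simp
qed

lemma sheafify_carrier: "x \<in> sheafify X M A U \<Longrightarrow> x \<in> carrier (msec M U)"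
  by (simp add: sheafify_def)

lemma subset_sheafify:
  assumes "opn U" "x \<in> carrier (msec M U)" "x \<in> A U"
  shows "x \<in> sheafify X M A U"
  using assms by (auto simp: sheafify_def mres_self intro: locally_on_self)

lemma sheafify_local:
  assumes "opn U" "x \<in> carrier (msec M U)"
    and "locally_on (pts X) U (\<lambda>V. mres M U V x \<in> sheafify X M A V)"
  shows "x \<in> sheafify X M A U"
proof -
  have "locally_on (pts X) V (\<lambda>W. mres M U W x \<in> A W)"
    if V: "opn V" "V \<subseteq> U" "mres M U V x \<in> sheafify X M A V" for V
  proof -
    have "locally_on (pts X) V (\<lambda>W. mres M V W (mres M U V x) \<in> A W)"
      using V(3) by (simp add: sheafify_def)
    then show ?thesis
      by (rule locally_on_bind) (use V assms(1,2) in \<open>simp add: mres_mres locally_on_self\<close>)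
  qed
  then have "locally_on (pts X) U (\<lambda>W. mres M U W x \<in> A W)"
    using locally_on_bind [OF assms(3)] by blast
  then show ?thesis using assms(2) by (simp add: sheafify_def)
qed

text \<open>
  The step by which local representatives are used: to show \<open>z\<close> in a subsheaf, restrict to open sets
  on which another section \<open>x\<close> has a representative.
\<close>

lemma sheafify_bind:
  assumes "x \<in> sheafify X M A U" "opn U" "z \<in> carrier (msec M U)"
    and "\<And>V. opn V \<Longrightarrow> V \<subseteq> U \<Longrightarrow> mres M U V x \<in> A V \<Longrightarrow> mres M U V z \<in> sheafify X M B V"
  shows "z \<in> sheafify X M B U"
proof (rule sheafify_local [OF assms(2,3)])
  have "locally_on (pts X) U (\<lambda>V. mres M U V x \<in> A V)"
    using assms(1) by (simp add: sheafify_def)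
  then show "locally_on (pts X) U (\<lambda>V. mres M U V z \<in> sheafify X M B V)"
    by (rule locally_on_bind) (use assms(4) in \<open>auto intro: locally_on_self\<close>)
qed

lemma sheafify_least:
  assumes "\<And>V. opn V \<Longrightarrow> A V \<subseteq> sheafify X M B V" "opn U"
  shows "sheafify X M A U \<subseteq> sheafify X M B U"
proof
  fix x assume x: "x \<in> sheafify X M A U"
  show "x \<in> sheafify X M B U"
    using assms(1) by (intro sheafify_bind [OF x assms(2) sheafify_carrier [OF x]]) blast
qed

lemma sheafify_cong:
  assumes "\<And>V. opn V \<Longrightarrow> A V = B V"
  shows "sheafify X M A U = sheafify X M B U"
  using assms by (auto simp: sheafify_def locally_on_def) metis+

lemma sheafify_res:
  assumes "x \<in> sheafify X M A U" "opn U" "opn V" "V \<subseteq> U"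
    and "\<And>V W z. opn V \<Longrightarrow> opn W \<Longrightarrow> W \<subseteq> V \<Longrightarrow> z \<in> A V \<Longrightarrow> mres M V W z \<in> A W"
  shows "mres M U V x \<in> sheafify X M A V"
proof -
  have x: "x \<in> carrier (msec M U)" using assms(1) by (rule sheafify_carrier)
  have "\<exists>W. opn W \<and> y \<in> W \<and> W \<subseteq> V \<and> mres M V W (mres M U V x) \<in> A W" if y: "y \<in> V" for y
  proof -
    obtain W where W: "opn W" "y \<in> W" "W \<subseteq> U" "mres M U W x \<in> A W"
      using assms(1,4) y unfolding sheafify_def locally_on_def by blast
    have o: "opn (W \<inter> V)" using W(1) assms(3) by (rule openin_Int)
    have "mres M W (W \<inter> V) (mres M U W x) \<in> A (W \<inter> V)"
      by (rule assms(5) [OF W(1) o _ W(4)]) simp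
    then have "mres M V (W \<inter> V) (mres M U V x) \<in> A (W \<inter> V)"
      using mres_mres [OF assms(2) W(1) o _ W(3) x] mres_mres [OF assms(2,3) o _ assms(4) x] by simp
    then show ?thesis using W(2) y o by blast
  qed
  then show ?thesis using mres_closed [OF assms(2-4) x] by (simp add: sheafify_def locally_on_def)
qed

end

section \<open>The structure sheaf as a module over itself\<close>

lemma struct_sheaf_simps:
  "carrier (msec (struct_sheaf X) U) = carrier (sec X U)"
  "x \<oplus>\<^bsub>msec (struct_sheaf X) U\<^esub> y = x \<oplus>\<^bsub>sec X U\<^esub> y"
  "a \<odot>\<^bsub>msec (struct_sheaf X) U\<^esub> b = a \<otimes>\<^bsub>sec X U\<^esub> b"
  "mres (struct_sheaf X) = res X"
  by (simp_all add: struct_sheaf_def scalars_along_def)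

lemma module_ring_module:
  assumes "cring A"
  shows "module A (ring_module A)"
proof -
  interpret cring A by (rule assms)
  have "abelian_group (ring_module A)"
  proof (rule abelian_groupI)
    show "\<exists>y\<in>carrier (ring_module A). y \<oplus>\<^bsub>ring_module A\<^esub> x = \<zero>\<^bsub>ring_module A\<^esub>"
      if "x \<in> carrier (ring_module A)" for x
      using that l_neg [of x] a_inv_closed [of x]
      by (auto simp: scalars_along_def)
  qed (auto simp: scalars_along_def intro: a_assoc a_comm)
  then show ?thesis
    by (intro moduleI assms) (simp_all add: scalars_along_def l_distr r_distr m_assoc)
qed

lemma is_mod_sheaf_struct_sheaf:
  assumes "is_ringed_space X"
  shows "is_mod_sheaf X (struct_sheaf X)"
  unfolding is_mod_sheaf_def
proof (intro conjI allI impI ballI; (elim conjE)?)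
  show "set_sheaf (pts X) (\<lambda>U. carrier (msec (struct_sheaf X) U)) (mres (struct_sheaf X))"
    unfolding struct_sheaf_simps using assms by (simp add: is_ringed_space_def)
  show "module (sec X U) (msec (struct_sheaf X) U)" if "openin (pts X) U" for U
    using assms that by (simp add: struct_sheaf_def module_ring_module is_ringed_space_def)
  fix U V assume "openin (pts X) U" "openin (pts X) V" "V \<subseteq> U"
  then have hom: "res X U V \<in> ring_hom (sec X U) (sec X V)"
    using assms by (simp add: is_ringed_space_def)
  show "mres (struct_sheaf X) U V \<in>
      hom (add_monoid (msec (struct_sheaf X) U)) (add_monoid (msec (struct_sheaf X) V))"
    using hom by (auto simp: hom_def ring_hom_def struct_sheaf_simps)
  show "mres (struct_sheaf X) U V (a \<odot>\<^bsub>msec (struct_sheaf X) U\<^esub> x) =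
      res X U V a \<odot>\<^bsub>msec (struct_sheaf X) V\<^esub> mres (struct_sheaf X) U V x"
    if "a \<in> carrier (sec X U)" "x \<in> carrier (msec (struct_sheaf X) U)" for a x
    using that unfolding struct_sheaf_simps by (rule ring_hom_mult [OF hom])
qed

section \<open>Powers of a principal ideal times a submodule\<close>

locale principal_ideal_action = sheaf_of_modules X M
  for X :: "('a, 'b) ringed_space" and M :: "('a, 'b, 'm) mod_sheaf" +
  fixes \<I> :: "'a set \<Rightarrow> 'b set"
  assumes ideal: "ideal_sheaf X \<I>" and principal: "locally_principal X \<I>"
begin

abbreviation "gen \<equiv> local_generators X \<I>"
abbreviation "pw \<equiv> power_multiples X M \<I>"

lemma ideal_carrier: "opn U \<Longrightarrow> a \<in> \<I> U \<Longrightarrow> a \<in> carrier (sec X U)"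
  using ideal subgroup.subset [OF submodule.axioms(1), of "\<I> U" "sec X U" "msec (struct_sheaf X) U"]
  by (auto simp: submodule_sheaf_def struct_sheaf_simps)

lemma ideal_res: "opn U \<Longrightarrow> opn V \<Longrightarrow> V \<subseteq> U \<Longrightarrow> a \<in> \<I> U \<Longrightarrow> res X U V a \<in> \<I> V"
  using ideal by (auto simp: submodule_sheaf_def struct_sheaf_simps Pi_iff)

lemma gen_ideal: "f \<in> gen U \<Longrightarrow> f \<in> \<I> U"
  by (simp add: local_generators_def)

lemma gen_carrier: "opn U \<Longrightarrow> f \<in> gen U \<Longrightarrow> f \<in> carrier (sec X U)"
  by (rule ideal_carrier [OF _ gen_ideal])

lemma gen_divides:
  assumes "opn U" "f \<in> gen U" "s \<in> \<I> U"
  shows "locally_on (pts X) U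
    (\<lambda>V. \<exists>a\<in>carrier (sec X V). res X U V s = a \<otimes>\<^bsub>sec X V\<^esub> res X U V f)"
  using assms by (auto simp: local_generators_def)

lemma gen_res:
  assumes "opn U" "opn V" "V \<subseteq> U" "f \<in> gen U"
  shows "res X U V f \<in> gen V"
proof -
  have "locally_on (pts X) W
      (\<lambda>W'. \<exists>a\<in>carrier (sec X W'). res X W W' s = a \<otimes>\<^bsub>sec X W'\<^esub> res X V W' (res X U V f))"
    if W: "opn W" "W \<subseteq> V" "s \<in> \<I> W" for W s
  proof -
    have "locally_on (pts X) W
        (\<lambda>W'. \<exists>a\<in>carrier (sec X W'). res X W W' s = a \<otimes>\<^bsub>sec X W'\<^esub> res X U W' f)"
      using assms(3,4) W by (auto simp: local_generators_def)
    then show ?thesis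
      by (rule locally_on_bind, intro locally_on_self)
        (use assms W in \<open>auto simp: res_res gen_carrier\<close>)
  qed
  then show ?thesis
    using ideal_res [OF assms(1-3) gen_ideal [OF assms(4)]] by (simp add: local_generators_def)
qed

lemma gen_exists:
  assumes "opn U"
  shows "locally_on (pts X) U (\<lambda>V. gen V \<noteq> {})"
  unfolding locally_on_def
proof
  fix x assume x: "x \<in> U"
  then have "x \<in> topspace (pts X)" using openin_subset [OF assms] by blast
  from bspec [OF principal [unfolded locally_principal_def] this]
  obtain V f where V: "opn V" "x \<in> V" "f \<in> gen V"
    unfolding local_generators_def mem_Collect_eq by (elim exE conjE bexE) (simp only: simp_thms)
  have o: "opn (U \<inter> V)" using assms V(1) by (rule openin_Int)
  have "res X V (U \<inter> V) f \<in> gen (U \<inter> V)" by (rule gen_res [OF V(1) o _ V(3)]) simp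
  then show "\<exists>V. opn V \<and> x \<in> V \<and> V \<subseteq> U \<and> gen V \<noteq> {}" using o x V(2) by blast
qed

end

lemma (in module) smult_left_commute:
  "a \<in> carrier R \<Longrightarrow> b \<in> carrier R \<Longrightarrow> x \<in> carrier M \<Longrightarrow>
   a \<odot>\<^bsub>M\<^esub> (b \<odot>\<^bsub>M\<^esub> x) = b \<odot>\<^bsub>M\<^esub> (a \<odot>\<^bsub>M\<^esub> x)"
  by (simp add: smult_assoc1 [symmetric] R.m_comm)

locale ideal_power_times_submodule = principal_ideal_action X M \<I>
  for X :: "('a, 'b) ringed_space" and M :: "('a, 'b, 'm) mod_sheaf" and \<I> :: "'a set \<Rightarrow> 'b set" +
  fixes K :: "'a set \<Rightarrow> 'm set"
  assumes submodules: "submodule_sheaf X M K"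
begin

lemma K_submodule: "opn U \<Longrightarrow> submodule (K U) (sec X U) (msec M U)"
  using submodules by (simp add: submodule_sheaf_def)

lemma K_carrier: "opn U \<Longrightarrow> x \<in> K U \<Longrightarrow> x \<in> carrier (msec M U)"
  by (rule subsetD [OF module.submoduleE(1) [OF module_msec K_submodule]])

lemma K_res: "opn U \<Longrightarrow> opn V \<Longrightarrow> V \<subseteq> U \<Longrightarrow> x \<in> K U \<Longrightarrow> mres M U V x \<in> K V"
  using submodules by (auto simp: submodule_sheaf_def Pi_iff)

lemma K_smult: "opn U \<Longrightarrow> a \<in> carrier (sec X U) \<Longrightarrow> x \<in> K U \<Longrightarrow> a \<odot>\<^bsub>msec M U\<^esub> x \<in> K U"
  by (rule module.submoduleE(4) [OF module_msec K_submodule])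

lemma K_add: "opn U \<Longrightarrow> x \<in> K U \<Longrightarrow> y \<in> K U \<Longrightarrow> x \<oplus>\<^bsub>msec M U\<^esub> y \<in> K U"
  by (rule module.submoduleE(5) [OF module_msec K_submodule])

lemma K_zero: "opn U \<Longrightarrow> \<zero>\<^bsub>msec M U\<^esub> \<in> K U"
  using subgroup.one_closed submodule.axioms(1) [OF K_submodule] by fastforce

lemma pw_memI: "f \<in> gen U \<Longrightarrow> y \<in> K U \<Longrightarrow> (f [^]\<^bsub>sec X U\<^esub> n) \<odot>\<^bsub>msec M U\<^esub> y \<in> pw n K U"
  by (auto simp: power_multiples_def)

lemma pw_carrier: "opn U \<Longrightarrow> z \<in> pw n K U \<Longrightarrow> z \<in> carrier (msec M U)"
  unfolding power_multiples_def
  by clarify (rule smult_closed [OF _ power_closed [OF _ gen_carrier] K_carrier])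

lemma mres_power_smult:
  assumes "opn U" "opn V" "V \<subseteq> U" "f \<in> carrier (sec X U)" "y \<in> carrier (msec M U)"
  shows "mres M U V ((f [^]\<^bsub>sec X U\<^esub> (n::nat)) \<odot>\<^bsub>msec M U\<^esub> y) =
    (res X U V f [^]\<^bsub>sec X V\<^esub> n) \<odot>\<^bsub>msec M V\<^esub> mres M U V y"
  using assms by (simp add: mres_smult power_closed res_power)

lemma pw_res:
  assumes "opn U" "opn V" "V \<subseteq> U" "z \<in> pw n K U"
  shows "mres M U V z \<in> pw n K V"
proof -
  obtain f y where "f \<in> gen U" "y \<in> K U" "z = (f [^]\<^bsub>sec X U\<^esub> n) \<odot>\<^bsub>msec M U\<^esub> y"
    using assms(4) by (auto simp: power_multiples_def)
  then show ?thesis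
    using assms(1-3) by (simp add: mres_power_smult gen_carrier K_carrier pw_memI gen_res K_res)
qed

lemma pw_subset: "opn U \<Longrightarrow> z \<in> pw n K U \<Longrightarrow> z \<in> sheafify X M (pw n K) U"
  by (rule subset_sheafify) (auto intro: pw_carrier)

text \<open>
  If \<open>g = a f\<close> locally, then \<open>f^n y + g^n x = f^n (y + a^n x)\<close>.
\<close>

lemma pw_add:
  assumes "opn U" "z \<in> pw n K U" "w \<in> pw n K U"
  shows "z \<oplus>\<^bsub>msec M U\<^esub> w \<in> sheafify X M (pw n K) U"
proof -
  obtain f y where f: "f \<in> gen U" "y \<in> K U" "z = (f [^]\<^bsub>sec X U\<^esub> n) \<odot>\<^bsub>msec M U\<^esub> y"
    using assms(2) by (auto simp: power_multiples_def)
  obtain g x where g: "g \<in> gen U" "x \<in> K U" "w = (g [^]\<^bsub>sec X U\<^esub> n) \<odot>\<^bsub>msec M U\<^esub> x"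
    using assms(3) by (auto simp: power_multiples_def)
  have zw: "z \<in> carrier (msec M U)" "w \<in> carrier (msec M U)"
    using pw_carrier assms by blast+
  interpret U: module "sec X U" "msec M U" by (rule module_msec [OF assms(1)])
  have "mres M U V (z \<oplus>\<^bsub>msec M U\<^esub> w) \<in> sheafify X M (pw n K) V"
    if V: "opn V" "V \<subseteq> U" "a \<in> carrier (sec X V)"
      "res X U V g = a \<otimes>\<^bsub>sec X V\<^esub> res X U V f" for V a
  proof -
    interpret V: module "sec X V" "msec M V" by (rule module_msec [OF V(1)])
    have c: "res X U V f \<in> carrier (sec X V)" "mres M U V y \<in> K V" "mres M U V x \<in> K V"
      "mres M U V y \<in> carrier (msec M V)" "mres M U V x \<in> carrier (msec M V)"
      using f g assms(1) V(1,2) by (auto intro: res_closed gen_carrier K_res K_carrier)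
    have "mres M U V (z \<oplus>\<^bsub>msec M U\<^esub> w) =
      (res X U V f [^]\<^bsub>sec X V\<^esub> n) \<odot>\<^bsub>msec M V\<^esub>
        (mres M U V y \<oplus>\<^bsub>msec M V\<^esub> (a [^]\<^bsub>sec X V\<^esub> n) \<odot>\<^bsub>msec M V\<^esub> mres M U V x)"
      using f g assms(1) V zw c
      by (simp add: mres_add mres_power_smult gen_carrier K_carrier V.smult_r_distr
          V.R.nat_pow_distrib V.smult_assoc1 V.smult_left_commute [of "a [^]\<^bsub>sec X V\<^esub> n"])
    moreover have "\<dots> \<in> pw n K V"
      using f(1) assms(1) V(1-3) c
      by (intro pw_memI gen_res K_add K_smult V.R.nat_pow_closed)
    ultimately show ?thesis using pw_subset V(1) by simp
  qed
  then show ?thesis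
    using zw gen_divides [OF assms(1) f(1) gen_ideal [OF g(1)]]
    by (intro sheafify_local [OF assms(1)]) (auto elim!: locally_on_bind intro!: locally_on_self)
qed

lemma sheafify_pw_add:
  assumes "opn U" "z \<in> sheafify X M (pw n K) U" "w \<in> sheafify X M (pw n K) U"
  shows "z \<oplus>\<^bsub>msec M U\<^esub> w \<in> sheafify X M (pw n K) U"
proof -
  have step: "z \<oplus>\<^bsub>msec M U\<^esub> w \<in> sheafify X M (pw n K) U"
    if "opn U" "z \<in> pw n K U" "w \<in> sheafify X M (pw n K) U" for U z w
  proof -
    interpret U: module "sec X U" "msec M U" by (rule module_msec [OF that(1)])
    have zw: "z \<in> carrier (msec M U)" "w \<in> carrier (msec M U)"
      using that pw_carrier sheafify_carrier by blast+
    show ?thesis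
      by (rule sheafify_bind [OF that(3,1)]) (use zw that pw_add pw_res in \<open>simp_all add: mres_add\<close>)
  qed
  interpret U: module "sec X U" "msec M U" by (rule module_msec [OF assms(1)])
  have zw: "z \<in> carrier (msec M U)" "w \<in> carrier (msec M U)"
    using assms sheafify_carrier by blast+
  show ?thesis
    by (rule sheafify_bind [OF assms(2,1)])
      (use zw assms step sheafify_res [OF assms(3) _ _ _ pw_res] in \<open>simp_all add: mres_add\<close>)
qed

lemma sheafify_pw_smult:
  assumes "opn U" "a \<in> carrier (sec X U)" "z \<in> sheafify X M (pw n K) U"
  shows "a \<odot>\<^bsub>msec M U\<^esub> z \<in> sheafify X M (pw n K) U"
proof (rule sheafify_bind [OF assms(3,1)])
  have z: "z \<in> carrier (msec M U)" using assms(3) by (rule sheafify_carrier)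
  then show "a \<odot>\<^bsub>msec M U\<^esub> z \<in> carrier (msec M U)" using smult_closed assms by blast
  fix V assume V: "opn V" "V \<subseteq> U" "mres M U V z \<in> pw n K V"
  interpret V: module "sec X V" "msec M V" by (rule module_msec [OF V(1)])
  define b where "b = res X U V a"
  have b: "b \<in> carrier (sec X V)" using res_closed assms(1,2) V(1,2) by (simp add: b_def)
  obtain f y where f: "f \<in> gen V" "y \<in> K V" "mres M U V z = (f [^]\<^bsub>sec X V\<^esub> n) \<odot>\<^bsub>msec M V\<^esub> y"
    using V(3) by (auto simp: power_multiples_def)
  have fy: "f \<in> carrier (sec X V)" "y \<in> carrier (msec M V)"
    using f gen_carrier K_carrier V(1) by blast+
  have "mres M U V (a \<odot>\<^bsub>msec M U\<^esub> z) = b \<odot>\<^bsub>msec M V\<^esub> ((f [^]\<^bsub>sec X V\<^esub> n) \<odot>\<^bsub>msec M V\<^esub> y)"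
    using assms V z f(3) by (simp add: mres_smult b_def)
  also have "\<dots> = (f [^]\<^bsub>sec X V\<^esub> n) \<odot>\<^bsub>msec M V\<^esub> (b \<odot>\<^bsub>msec M V\<^esub> y)"
    using fy b by (intro V.smult_left_commute) simp_all
  also have "\<dots> \<in> sheafify X M (pw n K) V"
    using f b V(1) by (intro pw_subset pw_memI K_smult)
  finally show "mres M U V (a \<odot>\<^bsub>msec M U\<^esub> z) \<in> sheafify X M (pw n K) V" .
qed

lemma sheafify_pw_subgroup:
  assumes "opn U"
  shows "subgroup (sheafify X M (pw n K) U) (add_monoid (msec M U))"
proof -
  interpret U: module "sec X U" "msec M U" by (rule module_msec [OF assms])
  have zero: "\<zero>\<^bsub>msec M U\<^esub> \<in> sheafify X M (pw n K) U"
  proof (rule sheafify_local [OF assms])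
    show "locally_on (pts X) U (\<lambda>V. mres M U V \<zero>\<^bsub>msec M U\<^esub> \<in> sheafify X M (pw n K) V)"
    proof (rule locally_on_bind [OF gen_exists [OF assms]], rule locally_on_self)
      fix V assume V: "opn V" "V \<subseteq> U" "gen V \<noteq> {}"
      interpret V: module "sec X V" "msec M V" by (rule module_msec [OF V(1)])
      obtain f where f: "f \<in> gen V" using V(3) by blast
      have "mres M U V (\<zero>\<^bsub>sec X U\<^esub> \<odot>\<^bsub>msec M U\<^esub> \<zero>\<^bsub>msec M U\<^esub>) =
          res X U V \<zero>\<^bsub>sec X U\<^esub> \<odot>\<^bsub>msec M V\<^esub> mres M U V \<zero>\<^bsub>msec M U\<^esub>"
        by (rule mres_smult) (use assms V in auto)
      moreover have "res X U V \<zero>\<^bsub>sec X U\<^esub> = \<zero>\<^bsub>sec X V\<^esub>"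
        using ring_hom_zero [OF res_hom] assms V(1,2) U.R.ring_axioms V.R.ring_axioms by blast
      ultimately have "mres M U V \<zero>\<^bsub>msec M U\<^esub> = \<zero>\<^bsub>msec M V\<^esub>"
        using mres_closed assms V(1,2) by simp
      also have "\<dots> = (f [^]\<^bsub>sec X V\<^esub> n) \<odot>\<^bsub>msec M V\<^esub> \<zero>\<^bsub>msec M V\<^esub>"
        using gen_carrier [OF V(1) f] by simp
      also have "\<dots> \<in> sheafify X M (pw n K) V"
        by (intro pw_subset pw_memI V f K_zero)
      finally show "mres M U V \<zero>\<^bsub>msec M U\<^esub> \<in> sheafify X M (pw n K) V" .
    qed
  qed simp
  have minus: "\<ominus>\<^bsub>msec M U\<^esub> z \<in> sheafify X M (pw n K) U" if z: "z \<in> sheafify X M (pw n K) U" for z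
  proof -
    have "\<ominus>\<^bsub>msec M U\<^esub> z = (\<ominus>\<^bsub>sec X U\<^esub> \<one>\<^bsub>sec X U\<^esub>) \<odot>\<^bsub>msec M U\<^esub> z"
      using sheafify_carrier [OF z] by (simp add: U.smult_l_minus)
    then show ?thesis using sheafify_pw_smult [OF assms _ z] by simp
  qed
  show ?thesis
    by (rule U.add.subgroupI)
      (use zero minus sheafify_pw_add [OF assms] sheafify_carrier in
        \<open>auto simp: a_inv_def [symmetric]\<close>)
qed

text \<open>
  As the right-hand side consists of additive subgroups, it is enough to consider single products.
\<close>

lemma ideal_smult_subset:
  assumes "\<And>V a y. opn V \<Longrightarrow> a \<in> J V \<Longrightarrow> y \<in> N V \<Longrightarrow>
      a \<odot>\<^bsub>msec M V\<^esub> y \<in> sheafify X M (pw n K) V"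
    and "opn U"
  shows "ideal_smult X M J N U \<subseteq> sheafify X M (pw n K) U"
proof -
  have "generate (add_monoid (msec M V)) {a \<odot>\<^bsub>msec M V\<^esub> y | a y. a \<in> J V \<and> y \<in> N V}
      \<subseteq> sheafify X M (pw n K) V" if V: "opn V" for V
  proof -
    interpret V: module "sec X V" "msec M V" by (rule module_msec [OF V])
    show ?thesis
      by (rule V.add.generate_subgroup_incl [OF _ sheafify_pw_subgroup [OF V]])
        (use assms(1) V in blast)
  qed
  from sheafify_least [OF this assms(2)] show ?thesis
    by (simp add: ideal_smult_def sheafify_def)
qed

end

lemma submodule_sheaf_struct_sheaf:
  assumes "is_ringed_space X"
  shows "submodule_sheaf X (struct_sheaf X) (\<lambda>V. carrier (sec X V))"
proof -
  interpret sheaf_of_modules X "struct_sheaf X"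
    by unfold_locales (use assms is_mod_sheaf_struct_sheaf in auto)
  have "submodule (carrier (sec X U)) (sec X U) (msec (struct_sheaf X) U)" if "opn U" for U
    using module.carrier_is_submodule [OF module_msec [OF that]] by (simp add: struct_sheaf_simps)
  then show ?thesis
    by (auto simp: submodule_sheaf_def struct_sheaf_simps res_closed)
qed

text \<open>
  Sections of \<open>\<I>^n\<close> are locally multiples of \<open>f^n\<close>.  In the induction step, \<open>a \<in> \<I>\<close> and
  \<open>y = f^n b\<close> have the product \<open>(c f) (f^n b) = f^(n + 1) (c b)\<close>, where \<open>a = c f\<close> holds on a smaller
  open set.
\<close>

lemma ideal_pow_subset_sheafify:
  assumes "is_ringed_space X" "ideal_sheaf X \<I>" "locally_principal X \<I>" "openin (pts X) U"
  shows "ideal_pow X \<I> n U \<subseteq> sheafify X (struct_sheaf X)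
    (power_multiples X (struct_sheaf X) \<I> n (\<lambda>V. carrier (sec X V))) U"
  using assms(4)
proof (induction n arbitrary: U)
  interpret ideal_power_times_submodule X "struct_sheaf X" \<I> "\<lambda>V. carrier (sec X V)"
    by unfold_locales
      (use assms is_mod_sheaf_struct_sheaf submodule_sheaf_struct_sheaf in auto)
  let ?O = "\<lambda>V. carrier (sec X V)"
  {
    case 0
    show ?case
    proof
      fix a assume "a \<in> ideal_pow X \<I> 0 U"
      then have a: "a \<in> carrier (sec X U)" by simp
      show "a \<in> sheafify X (struct_sheaf X) (pw 0 ?O) U"
      proof (rule sheafify_local [OF 0])
        show "a \<in> carrier (msec (struct_sheaf X) U)" using a by (simp add: struct_sheaf_simps)
        show "locally_on (pts X) U
          (\<lambda>V. mres (struct_sheaf X) U V a \<in> sheafify X (struct_sheaf X) (pw 0 ?O) V)"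
        proof (rule locally_on_bind [OF gen_exists [OF 0]], rule locally_on_self)
          fix V assume V: "opn V" "V \<subseteq> U" "gen V \<noteq> {}"
          interpret V: cring "sec X V" by (rule ring_sec [OF V(1)])
          obtain f where f: "f \<in> gen V" using V(3) by blast
          have r: "res X U V a \<in> carrier (sec X V)" using res_closed 0 V(1,2) a by simp
          have "(f [^]\<^bsub>sec X V\<^esub> (0::nat)) \<odot>\<^bsub>msec (struct_sheaf X) V\<^esub> res X U V a \<in> pw 0 ?O V"
            by (rule pw_memI [OF f r])
          then show "mres (struct_sheaf X) U V a \<in> sheafify X (struct_sheaf X) (pw 0 ?O) V"
            using r by (intro pw_subset [OF V(1)]) (simp add: struct_sheaf_simps)
        qed
      qed
    qed
  next
    case (Suc n)
    show ?case
      unfolding ideal_pow.simps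
    proof (rule ideal_smult_subset [OF _ Suc.prems])
      fix V a y assume V: "opn V" and a: "a \<in> \<I> V" and y: "y \<in> ideal_pow X \<I> n V"
      have aV: "a \<in> carrier (sec X V)" by (rule ideal_carrier [OF V a])
      have y': "y \<in> sheafify X (struct_sheaf X) (pw n ?O) V" using Suc.IH [OF V] y by blast
      have yV: "y \<in> carrier (msec (struct_sheaf X) V)" by (rule sheafify_carrier [OF y'])
      show "a \<odot>\<^bsub>msec (struct_sheaf X) V\<^esub> y \<in> sheafify X (struct_sheaf X) (pw (Suc n) ?O) V"
      proof (rule sheafify_bind [OF y' V smult_closed [OF V aV yV]])
        fix W assume W: "opn W" "W \<subseteq> V" "mres (struct_sheaf X) V W y \<in> pw n ?O W"
        then obtain f b where f: "f \<in> gen W" and b: "b \<in> carrier (sec X W)"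
          and y_eq: "res X V W y = (f [^]\<^bsub>sec X W\<^esub> n) \<otimes>\<^bsub>sec X W\<^esub> b"
          by (auto simp: power_multiples_def struct_sheaf_simps)
        have fW: "f \<in> carrier (sec X W)" by (rule gen_carrier [OF W(1) f])
        have "a \<odot>\<^bsub>msec (struct_sheaf X) V\<^esub> y \<in> carrier (msec (struct_sheaf X) V)"
          by (rule smult_closed [OF V aV yV])
        note ay = mres_closed [OF V W(1,2) this]
        show "mres (struct_sheaf X) V W (a \<odot>\<^bsub>msec (struct_sheaf X) V\<^esub> y)
            \<in> sheafify X (struct_sheaf X) (pw (Suc n) ?O) W"
        proof (rule sheafify_local [OF W(1) ay],
            rule locally_on_bind [OF gen_divides [OF W(1) f ideal_res [OF V W(1,2) a]]],
            rule locally_on_self)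
          fix Z assume Z: "opn Z" "Z \<subseteq> W"
            and "\<exists>c\<in>carrier (sec X Z). res X W Z (res X V W a) = c \<otimes>\<^bsub>sec X Z\<^esub> res X W Z f"
          then obtain c where c: "c \<in> carrier (sec X Z)"
            and a_eq: "res X W Z (res X V W a) = c \<otimes>\<^bsub>sec X Z\<^esub> res X W Z f" by blast
          interpret W: cring "sec X W" by (rule ring_sec [OF W(1)])
          interpret Z: cring "sec X Z" by (rule ring_sec [OF Z(1)])
          define g d where "g = res X W Z f" and "d = res X W Z b"
          have gd: "g \<in> carrier (sec X Z)" "d \<in> carrier (sec X Z)" "g \<in> gen Z"
            using res_closed [OF W(1) Z] gen_res [OF W(1) Z f] fW b by (simp_all add: g_def d_def)
          have "mres (struct_sheaf X) W Z (mres (struct_sheaf X) V W (a \<odot>\<^bsub>msec (struct_sheaf X) V\<^esub> y))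
              = (c \<otimes>\<^bsub>sec X Z\<^esub> g) \<otimes>\<^bsub>sec X Z\<^esub> ((g [^]\<^bsub>sec X Z\<^esub> n) \<otimes>\<^bsub>sec X Z\<^esub> d)"
            using V W(1,2) Z aV yV fW b a_eq y_eq
            by (simp add: struct_sheaf_simps res_mult res_closed res_power power_closed g_def d_def)
          also have "\<dots> = (g [^]\<^bsub>sec X Z\<^esub> Suc n) \<odot>\<^bsub>msec (struct_sheaf X) Z\<^esub> (c \<otimes>\<^bsub>sec X Z\<^esub> d)"
            using c gd by (simp add: struct_sheaf_simps Z.m_ac)
          also have "\<dots> \<in> sheafify X (struct_sheaf X) (pw (Suc n) ?O) Z"
            by (intro pw_subset [OF Z(1)] pw_memI gd) (use c gd in simp)
          finally show "mres (struct_sheaf X) W Z (mres (struct_sheaf X) V W (a \<odot>\<^bsub>msec (struct_sheaf X) V\<^esub> y))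
              \<in> sheafify X (struct_sheaf X) (pw (Suc n) ?O) Z" .
        qed
      qed
    qed
  }
qed

context ideal_power_times_submodule
begin

lemma power_in_ideal_pow:
  assumes "opn U" "f \<in> \<I> U"
  shows "f [^]\<^bsub>sec X U\<^esub> n \<in> ideal_pow X \<I> n U"
proof (induction n)
  case 0
  interpret cring "sec X U" by (rule ring_sec [OF assms(1)])
  show ?case by simp
next
  case (Suc n)
  interpret cring "sec X U" by (rule ring_sec [OF assms(1)])
  have f: "f \<in> carrier (sec X U)" by (rule ideal_carrier [OF assms])
  have "f [^]\<^bsub>sec X U\<^esub> Suc n = f \<odot>\<^bsub>msec (struct_sheaf X) U\<^esub> (f [^]\<^bsub>sec X U\<^esub> n)"
    using f by (simp add: struct_sheaf_simps m_comm)
  then have "f [^]\<^bsub>sec X U\<^esub> Suc n \<in> generate (add_monoid (msec (struct_sheaf X) U))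
      {a \<odot>\<^bsub>msec (struct_sheaf X) U\<^esub> y | a y. a \<in> \<I> U \<and> y \<in> ideal_pow X \<I> n U}"
    using assms(2) Suc.IH by (intro generate.incl) blast
  then show ?case
    using f assms(1)
    by (simp add: ideal_smult_def locally_on_self struct_sheaf_simps res_self del: nat_pow_Suc)
qed

lemma ideal_smult_ideal_pow:
  assumes "opn U"
  shows "ideal_smult X M (ideal_pow X \<I> n) K U = sheafify X M (pw n K) U"
proof
  show "ideal_smult X M (ideal_pow X \<I> n) K U \<subseteq> sheafify X M (pw n K) U"
  proof (rule ideal_smult_subset [OF _ assms])
    fix V a y assume V: "opn V" and a: "a \<in> ideal_pow X \<I> n V" and y: "y \<in> K V"
    have a': "a \<in> sheafify X (struct_sheaf X)
        (power_multiples X (struct_sheaf X) \<I> n (\<lambda>V. carrier (sec X V))) V"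
      using ideal_pow_subset_sheafify [OF ringed ideal principal V] a by blast
    then have aV: "a \<in> carrier (sec X V)"
      by (simp add: sheafify_def struct_sheaf_simps)
    have loc: "locally_on (pts X) V
      (\<lambda>W. res X V W a \<in> power_multiples X (struct_sheaf X) \<I> n (\<lambda>V. carrier (sec X V)) W)"
      using a' by (simp add: sheafify_def struct_sheaf_simps)
    have yV: "y \<in> carrier (msec M V)" by (rule K_carrier [OF V y])
    show "a \<odot>\<^bsub>msec M V\<^esub> y \<in> sheafify X M (pw n K) V"
    proof (rule sheafify_local [OF V smult_closed [OF V aV yV]],
        rule locally_on_bind [OF loc], rule locally_on_self)
      fix W assume W: "opn W" "W \<subseteq> V"
        and "res X V W a \<in> power_multiples X (struct_sheaf X) \<I> n (\<lambda>V. carrier (sec X V)) W"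
      then obtain f b where f: "f \<in> gen W" and b: "b \<in> carrier (sec X W)"
        and a_eq: "res X V W a = (f [^]\<^bsub>sec X W\<^esub> n) \<otimes>\<^bsub>sec X W\<^esub> b"
        by (auto simp: power_multiples_def struct_sheaf_simps)
      interpret W: module "sec X W" "msec M W" by (rule module_msec [OF W(1)])
      have yW: "mres M V W y \<in> K W" by (rule K_res [OF V W y])
      have "mres M V W (a \<odot>\<^bsub>msec M V\<^esub> y) =
          (f [^]\<^bsub>sec X W\<^esub> n) \<odot>\<^bsub>msec M W\<^esub> (b \<odot>\<^bsub>msec M W\<^esub> mres M V W y)"
        using gen_carrier [OF W(1) f] b K_carrier [OF W(1) yW]
        by (simp add: mres_smult [OF V W aV yV] a_eq W.smult_assoc1)
      also have "\<dots> \<in> sheafify X M (pw n K) W"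
        by (intro pw_subset pw_memI K_smult W(1) f b yW)
      finally show "mres M V W (a \<odot>\<^bsub>msec M V\<^esub> y) \<in> sheafify X M (pw n K) W" .
    qed
  qed
next
  have "pw n K V \<subseteq> generate (add_monoid (msec M V))
      {a \<odot>\<^bsub>msec M V\<^esub> y | a y. a \<in> ideal_pow X \<I> n V \<and> y \<in> K V}" if "opn V" for V
    using power_in_ideal_pow [OF that gen_ideal]
    by (auto simp: power_multiples_def intro!: generate.incl)
  then show "sheafify X M (pw n K) U \<subseteq> ideal_smult X M (ideal_pow X \<I> n) K U"
    unfolding sheafify_def ideal_smult_def
    by (auto elim!: locally_on_bind intro!: locally_on_self)
qed

end

section \<open>Images of powers of the ideal under the Cartier operator\<close>

locale cartier_ideal_action = ideal_power_times_submodule X M \<I> K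
  for X :: "('a, 'b) ringed_space" and M :: "('a, 'b, 'm) mod_sheaf" and \<I> :: "'a set \<Rightarrow> 'b set"
    and K :: "'a set \<Rightarrow> 'm set" +
  fixes q :: nat and C :: "'a set \<Rightarrow> 'm \<Rightarrow> 'm"
  assumes cartier: "cartier_module q X M C"
begin

lemma C_closed: "opn U \<Longrightarrow> x \<in> carrier (msec M U) \<Longrightarrow> C U x \<in> carrier (msec M U)"
  using cartier hom_in_carrier [of "C U" "add_monoid (msec M U)" "add_monoid (msec M U)" x]
  by (simp add: cartier_module_def)

lemma iterate_closed:
  "opn U \<Longrightarrow> x \<in> carrier (msec M U) \<Longrightarrow> (C U ^^ m) x \<in> carrier (msec M U)"
  by (induction m) (simp_all add: C_closed)

lemma iterate_res:
  "opn U \<Longrightarrow> opn V \<Longrightarrow> V \<subseteq> U \<Longrightarrow> x \<in> carrier (msec M U) \<Longrightarrow>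
   mres M U V ((C U ^^ m) x) = (C V ^^ m) (mres M U V x)"
  using cartier iterate_closed by (induction m) (simp_all add: cartier_module_def)

lemma iterate_smult:
  assumes "opn U" "a \<in> carrier (sec X U)" "x \<in> carrier (msec M U)"
  shows "(C U ^^ m) ((a [^]\<^bsub>sec X U\<^esub> (q ^ m)) \<odot>\<^bsub>msec M U\<^esub> x) = a \<odot>\<^bsub>msec M U\<^esub> (C U ^^ m) x"
  using assms(2)
proof (induction m arbitrary: a)
  case 0
  interpret module "sec X U" "msec M U" by (rule module_msec [OF assms(1)])
  show ?case using 0 by simp
next
  case (Suc m)
  interpret module "sec X U" "msec M U" by (rule module_msec [OF assms(1)])
  have "(C U ^^ Suc m) ((a [^]\<^bsub>sec X U\<^esub> (q ^ Suc m)) \<odot>\<^bsub>msec M U\<^esub> x) =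
      C U ((a [^]\<^bsub>sec X U\<^esub> q) \<odot>\<^bsub>msec M U\<^esub> (C U ^^ m) x)"
    using Suc.IH [of "a [^]\<^bsub>sec X U\<^esub> q"] Suc.prems by (simp add: R.nat_pow_pow)
  also have "\<dots> = a \<odot>\<^bsub>msec M U\<^esub> C U ((C U ^^ m) x)"
    using cartier assms(1) Suc.prems iterate_closed [OF assms(1,3)] by (simp add: cartier_module_def)
  finally show ?case by simp
qed

abbreviation power_image :: "nat \<Rightarrow> nat \<Rightarrow> ('a set \<Rightarrow> 'm set) \<Rightarrow> 'a set \<Rightarrow> 'm set" where
  "power_image m n N \<equiv> sheafify X M (\<lambda>V. (C V ^^ m) ` pw n N V)"

text \<open>
  \<open>C\<close> commutes with restriction, so it is enough to apply it to local representatives.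
\<close>

lemma cartier_image_sheafify:
  assumes "opn U" "\<And>V. opn V \<Longrightarrow> A V \<subseteq> carrier (msec M V)"
  shows "cartier_image X M C m (sheafify X M A) U = sheafify X M (\<lambda>V. (C V ^^ m) ` A V) U"
proof -
  have "sheafify X M (\<lambda>V. (C V ^^ m) ` sheafify X M A V) U = sheafify X M (\<lambda>V. (C V ^^ m) ` A V) U"
  proof
    show "sheafify X M (\<lambda>V. (C V ^^ m) ` sheafify X M A V) U \<subseteq> sheafify X M (\<lambda>V. (C V ^^ m) ` A V) U"
    proof (rule sheafify_least [OF _ assms(1)], safe)
      fix V y assume V: "opn V" and y: "y \<in> sheafify X M A V"
      have yV: "y \<in> carrier (msec M V)" by (rule sheafify_carrier [OF y])
      show "(C V ^^ m) y \<in> sheafify X M (\<lambda>V. (C V ^^ m) ` A V) V"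
      proof (rule sheafify_bind [OF y V iterate_closed [OF V yV]])
        fix W assume W: "opn W" "W \<subseteq> V" "mres M V W y \<in> A W"
        show "mres M V W ((C V ^^ m) y) \<in> sheafify X M (\<lambda>V. (C V ^^ m) ` A V) W"
          unfolding iterate_res [OF V W(1,2) yV]
          by (rule subset_sheafify [OF W(1) iterate_closed [OF W(1) mres_closed [OF V W(1,2) yV]]])
            (use W(3) in simp)
      qed
    qed
    show "sheafify X M (\<lambda>V. (C V ^^ m) ` A V) U \<subseteq> sheafify X M (\<lambda>V. (C V ^^ m) ` sheafify X M A V) U"
    proof (rule sheafify_least [OF _ assms(1)], safe)
      fix V y assume V: "opn V" and y: "y \<in> A V"
      then have yV: "y \<in> carrier (msec M V)" using assms(2) by blast
      show "(C V ^^ m) y \<in> sheafify X M (\<lambda>V. (C V ^^ m) ` sheafify X M A V) V"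
        by (rule subset_sheafify [OF V iterate_closed [OF V yV]])
          (use subset_sheafify [OF V yV] y in blast)
    qed
  qed
  then show ?thesis by (simp add: cartier_image_def sheafify_def)
qed

lemma cartier_image_ideal_pow:
  assumes "opn U"
  shows "cartier_image X M C m (ideal_smult X M (ideal_pow X \<I> n) K) U = power_image m n K U"
proof -
  have "cartier_image X M C m (ideal_smult X M (ideal_pow X \<I> n) K) U =
      cartier_image X M C m (sheafify X M (pw n K)) U"
    using sheafify_cong [of "\<lambda>V. (C V ^^ m) ` ideal_smult X M (ideal_pow X \<I> n) K V"
        "\<lambda>V. (C V ^^ m) ` sheafify X M (pw n K) V" U]
    by (simp add: ideal_smult_ideal_pow cartier_image_def sheafify_def)
  also have "\<dots> = power_image m n K U"
    using pw_carrier by (intro cartier_image_sheafify [OF assms]) blast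
  finally show ?thesis .
qed

lemma pw_image_subset:
  assumes "opn U" "x \<in> pw n K U"
  shows "(C U ^^ m) x \<in> power_image m n K U"
  by (rule subset_sheafify [OF assms(1) iterate_closed [OF assms(1) pw_carrier [OF assms]]])
    (use assms(2) in simp)

lemma power_image_antitone:
  assumes "opn U"
  shows "power_image m (Suc n) K U \<subseteq> power_image m n K U"
proof (rule sheafify_least [OF _ assms], safe)
  fix V x assume V: "opn V" and x: "x \<in> pw (Suc n) K V"
  interpret module "sec X V" "msec M V" by (rule module_msec [OF V])
  obtain f y where f: "f \<in> gen V" "y \<in> K V" "x = (f [^]\<^bsub>sec X V\<^esub> Suc n) \<odot>\<^bsub>msec M V\<^esub> y"
    using x by (auto simp: power_multiples_def)
  have fV: "f \<in> carrier (sec X V)" by (rule gen_carrier [OF V f(1)])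
  have "x = (f [^]\<^bsub>sec X V\<^esub> n) \<odot>\<^bsub>msec M V\<^esub> (f \<odot>\<^bsub>msec M V\<^esub> y)"
    using f(3) fV K_carrier [OF V f(2)] by (simp add: smult_assoc1)
  then have "x \<in> pw n K V" using f(1) K_smult [OF V fV f(2)] by (simp add: pw_memI)
  then show "(C V ^^ m) x \<in> power_image m n K V" by (rule pw_image_subset [OF V])
qed

text \<open>
  Apply \<open>C\<close> once more to a local identity \<open>C^m(f^n x) = C^m(g^(n + 1) y)\<close>.
\<close>

lemma power_image_persist:
  assumes "\<And>V. opn V \<Longrightarrow> power_image m n K V \<subseteq> power_image m (Suc n) K V" "opn U"
  shows "power_image (Suc m) n K U \<subseteq> power_image (Suc m) (Suc n) K U"
proof (rule sheafify_least [OF _ assms(2)], safe)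
  fix V x assume V: "opn V" and x: "x \<in> pw n K V"
  have w: "(C V ^^ m) x \<in> power_image m (Suc n) K V"
    using pw_image_subset [OF V x] assms(1) [OF V] by blast
  have wV: "(C V ^^ m) x \<in> carrier (msec M V)" by (rule sheafify_carrier [OF w])
  have z: "(C V ^^ Suc m) x = (C V ^^ 1) ((C V ^^ m) x)" by simp
  show "(C V ^^ Suc m) x \<in> power_image (Suc m) (Suc n) K V"
    unfolding z
  proof (rule sheafify_bind [OF w V iterate_closed [OF V wV]])
    fix W assume W: "opn W" "W \<subseteq> V" "mres M V W ((C V ^^ m) x) \<in> (C W ^^ m) ` pw (Suc n) K W"
    then obtain y where "y \<in> pw (Suc n) K W" "mres M V W ((C V ^^ m) x) = (C W ^^ m) y" by blast
    then show "mres M V W ((C V ^^ 1) ((C V ^^ m) x)) \<in> power_image (Suc m) (Suc n) K W"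
      using pw_image_subset [OF W(1), of y "Suc n" "Suc m"] by (simp only: iterate_res [OF V W(1,2) wV]) simp
  qed
qed

text \<open>
  With \<open>a = b g\<close> for a local generator \<open>g\<close>,
  \<open>a C^m(g^n k) = C^m(a^(q^m) g^n k) = C^m(g^(n + q^m) b^(q^m) k)\<close>.
\<close>

lemma smult_power_image:
  assumes "opn U" "a \<in> \<I> U" "x \<in> pw n K U"
  shows "a \<odot>\<^bsub>msec M U\<^esub> (C U ^^ m) x \<in> power_image m (n + q ^ m) K U"
proof -
  obtain f y where f: "f \<in> gen U" "y \<in> K U" "x = (f [^]\<^bsub>sec X U\<^esub> n) \<odot>\<^bsub>msec M U\<^esub> y"
    using assms(3) by (auto simp: power_multiples_def)
  have aU: "a \<in> carrier (sec X U)" by (rule ideal_carrier [OF assms(1,2)])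
  have xU: "x \<in> carrier (msec M U)" by (rule pw_carrier [OF assms(1,3)])
  show ?thesis
  proof (rule sheafify_local [OF assms(1) smult_closed [OF assms(1) aU iterate_closed [OF assms(1) xU]]],
      rule locally_on_bind [OF gen_divides [OF assms(1) f(1) assms(2)]], rule locally_on_self)
    fix V assume V: "opn V" "V \<subseteq> U"
      and "\<exists>b\<in>carrier (sec X V). res X U V a = b \<otimes>\<^bsub>sec X V\<^esub> res X U V f"
    then obtain b where b: "b \<in> carrier (sec X V)" "res X U V a = b \<otimes>\<^bsub>sec X V\<^esub> res X U V f" by blast
    interpret V: module "sec X V" "msec M V" by (rule module_msec [OF V(1)])
    define g k where "g = res X U V f" and "k = mres M U V y"
    have g: "g \<in> gen V" "g \<in> carrier (sec X V)"
      using gen_res [OF assms(1) V f(1)] gen_carrier [OF V(1)] by (auto simp: g_def)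
    have k: "k \<in> K V" "k \<in> carrier (msec M V)"
      using K_res [OF assms(1) V f(2)] K_carrier [OF V(1)] by (auto simp: k_def)
    have x_eq: "mres M U V x = (g [^]\<^bsub>sec X V\<^esub> n) \<odot>\<^bsub>msec M V\<^esub> k"
      unfolding f(3) g_def k_def
      by (rule mres_power_smult [OF assms(1) V gen_carrier [OF assms(1) f(1)] K_carrier [OF assms(1) f(2)]])
    have "mres M U V (a \<odot>\<^bsub>msec M U\<^esub> (C U ^^ m) x) =
        (b \<otimes>\<^bsub>sec X V\<^esub> g) \<odot>\<^bsub>msec M V\<^esub> (C V ^^ m) (mres M U V x)"
      by (simp only: mres_smult [OF assms(1) V aU iterate_closed [OF assms(1) xU]]
          iterate_res [OF assms(1) V xU] b(2) g_def)
    also have "\<dots> = (C V ^^ m) (((b \<otimes>\<^bsub>sec X V\<^esub> g) [^]\<^bsub>sec X V\<^esub> (q ^ m)) \<odot>\<^bsub>msec M V\<^esub> mres M U V x)"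
      using b(1) g(2) mres_closed [OF assms(1) V xU] by (intro iterate_smult [OF V(1), symmetric]) simp_all
    also have "((b \<otimes>\<^bsub>sec X V\<^esub> g) [^]\<^bsub>sec X V\<^esub> (q ^ m)) \<odot>\<^bsub>msec M V\<^esub> mres M U V x =
        (g [^]\<^bsub>sec X V\<^esub> (n + q ^ m)) \<odot>\<^bsub>msec M V\<^esub> ((b [^]\<^bsub>sec X V\<^esub> (q ^ m)) \<odot>\<^bsub>msec M V\<^esub> k)"
      using b(1) g(2) k(2)
      by (simp add: x_eq V.smult_assoc1 [symmetric] V.R.nat_pow_distrib V.R.nat_pow_mult [symmetric] V.R.m_ac)
    also have "(C V ^^ m) \<dots> \<in> power_image m (n + q ^ m) K V"
      using b(1) by (intro pw_image_subset [OF V(1)] pw_memI g(1) K_smult V(1) k(1)) simp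
    finally show "mres M U V (a \<odot>\<^bsub>msec M U\<^esub> (C U ^^ m) x) \<in> power_image m (n + q ^ m) K V" .
  qed
qed

text \<open>
  Every \<open>C^m(f^(n + q^m) y)\<close> equals \<open>f C^m(f^n y)\<close>.  The hypothesis turns \<open>C^m(f^n y)\<close> into an element of
  \<open>C^m(\<I>^(n + 1) K)\<close>, and multiplying it by \<open>f \<in> \<I>\<close> raises the exponent by \<open>q^m\<close>.
\<close>

lemma power_image_translate:
  assumes "\<And>V. opn V \<Longrightarrow> power_image m n K V \<subseteq> power_image m (Suc n) K V" "opn U"
  shows "power_image m (n + q ^ m) K U \<subseteq> power_image m (Suc n + q ^ m) K U"
proof (rule sheafify_least [OF _ assms(2)], safe)
  fix V x assume V: "opn V" and x: "x \<in> pw (n + q ^ m) K V"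
  interpret V: module "sec X V" "msec M V" by (rule module_msec [OF V])
  obtain f y where f: "f \<in> gen V" "y \<in> K V" "x = (f [^]\<^bsub>sec X V\<^esub> (n + q ^ m)) \<odot>\<^bsub>msec M V\<^esub> y"
    using x by (auto simp: power_multiples_def)
  have fV: "f \<in> carrier (sec X V)" by (rule gen_carrier [OF V f(1)])
  have yV: "y \<in> carrier (msec M V)" by (rule K_carrier [OF V f(2)])
  define w where "w = (C V ^^ m) ((f [^]\<^bsub>sec X V\<^esub> n) \<odot>\<^bsub>msec M V\<^esub> y)"
  have "x = (f [^]\<^bsub>sec X V\<^esub> (q ^ m)) \<odot>\<^bsub>msec M V\<^esub> ((f [^]\<^bsub>sec X V\<^esub> n) \<odot>\<^bsub>msec M V\<^esub> y)"
    using fV yV by (simp add: f(3) V.smult_assoc1 [symmetric] V.R.nat_pow_mult add.commute)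
  then have z: "(C V ^^ m) x = f \<odot>\<^bsub>msec M V\<^esub> w"
    unfolding w_def using iterate_smult [OF V fV] fV yV by simp
  have w: "w \<in> power_image m (Suc n) K V"
    using pw_image_subset [OF V pw_memI [OF f(1,2)]] assms(1) [OF V] unfolding w_def by blast
  have wV: "w \<in> carrier (msec M V)" by (rule sheafify_carrier [OF w])
  show "(C V ^^ m) x \<in> power_image m (Suc n + q ^ m) K V"
    unfolding z
  proof (rule sheafify_bind [OF w V smult_closed [OF V fV wV]])
    fix W assume W: "opn W" "W \<subseteq> V" "mres M V W w \<in> (C W ^^ m) ` pw (Suc n) K W"
    then obtain v where v: "v \<in> pw (Suc n) K W" "mres M V W w = (C W ^^ m) v" by blast
    show "mres M V W (f \<odot>\<^bsub>msec M V\<^esub> w) \<in> power_image m (Suc n + q ^ m) K W"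
      unfolding mres_smult [OF V W(1,2) fV wV] v(2)
      by (rule smult_power_image [OF W(1) ideal_res [OF V W(1,2) gen_ideal [OF f(1)]] v(1)])
  qed
qed

text \<open>
  This rests on \<open>f^n C^i(k) = C^i(f^(q^i n) k)\<close>.
\<close>

lemma power_image_cartier_image:
  assumes "opn U"
  shows "power_image m n (cartier_image X M C i K) U = power_image (m + i) (q ^ i * n) K U"
proof
  have cartier_image_eq: "cartier_image X M C i K = sheafify X M (\<lambda>V. (C V ^^ i) ` K V)"
    by (simp add: cartier_image_def sheafify_def fun_eq_iff)
  have exchange: "(C V ^^ m) ((f [^]\<^bsub>sec X V\<^esub> n) \<odot>\<^bsub>msec M V\<^esub> (C V ^^ i) k) =
      (C V ^^ (m + i)) ((f [^]\<^bsub>sec X V\<^esub> (q ^ i * n)) \<odot>\<^bsub>msec M V\<^esub> k)"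
    if "opn V" "f \<in> carrier (sec X V)" "k \<in> carrier (msec M V)" for V f k
  proof -
    interpret module "sec X V" "msec M V" by (rule module_msec [OF that(1)])
    show ?thesis
      using iterate_smult [OF that(1), of "f [^]\<^bsub>sec X V\<^esub> n" k i] that(2,3)
      by (simp add: funpow_add R.nat_pow_pow mult.commute)
  qed
  show "power_image m n (cartier_image X M C i K) U \<subseteq> power_image (m + i) (q ^ i * n) K U"
  proof (rule sheafify_least [OF _ assms], safe)
    fix V x assume V: "opn V" and "x \<in> pw n (cartier_image X M C i K) V"
    then obtain f y where f: "f \<in> gen V" and y: "y \<in> cartier_image X M C i K V"
      and x: "x = (f [^]\<^bsub>sec X V\<^esub> n) \<odot>\<^bsub>msec M V\<^esub> y"
      by (auto simp: power_multiples_def)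
    note y' = y [unfolded cartier_image_eq]
    have fV: "f \<in> carrier (sec X V)" by (rule gen_carrier [OF V f])
    have yV: "y \<in> carrier (msec M V)" by (rule sheafify_carrier [OF y'])
    have xV: "x \<in> carrier (msec M V)" unfolding x by (intro smult_closed power_closed V fV yV)
    show "(C V ^^ m) x \<in> power_image (m + i) (q ^ i * n) K V"
    proof (rule sheafify_bind [OF y' V iterate_closed [OF V xV]])
      fix W assume W: "opn W" "W \<subseteq> V" "mres M V W y \<in> (C W ^^ i) ` K W"
      then obtain k where k: "k \<in> K W" "mres M V W y = (C W ^^ i) k" by blast
      have g: "res X V W f \<in> gen W" by (rule gen_res [OF V W(1,2) f])
      have "mres M V W ((C V ^^ m) x) =
          (C W ^^ (m + i)) ((res X V W f [^]\<^bsub>sec X W\<^esub> (q ^ i * n)) \<odot>\<^bsub>msec M W\<^esub> k)"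
        unfolding x iterate_res [OF V W(1,2) xV [unfolded x]] mres_power_smult [OF V W(1,2) fV yV] k(2)
        by (rule exchange [OF W(1) gen_carrier [OF W(1) g] K_carrier [OF W(1) k(1)]])
      also have "\<dots> \<in> power_image (m + i) (q ^ i * n) K W"
        by (rule pw_image_subset [OF W(1) pw_memI [OF g k(1)]])
      finally show "mres M V W ((C V ^^ m) x) \<in> power_image (m + i) (q ^ i * n) K W" .
    qed
  qed
  show "power_image (m + i) (q ^ i * n) K U \<subseteq> power_image m n (cartier_image X M C i K) U"
  proof (rule sheafify_least [OF _ assms], safe)
    fix V x assume V: "opn V" and "x \<in> pw (q ^ i * n) K V"
    then obtain f k where f: "f \<in> gen V" and k: "k \<in> K V"
      and x: "x = (f [^]\<^bsub>sec X V\<^esub> (q ^ i * n)) \<odot>\<^bsub>msec M V\<^esub> k"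
      by (auto simp: power_multiples_def)
    have fV: "f \<in> carrier (sec X V)" by (rule gen_carrier [OF V f])
    have kV: "k \<in> carrier (msec M V)" by (rule K_carrier [OF V k])
    have "(C V ^^ i) k \<in> cartier_image X M C i K V"
      unfolding cartier_image_eq
      by (rule subset_sheafify [OF V iterate_closed [OF V kV]]) (use k in simp)
    then have "(f [^]\<^bsub>sec X V\<^esub> n) \<odot>\<^bsub>msec M V\<^esub> (C V ^^ i) k \<in> pw n (cartier_image X M C i K) V"
      using f by (auto simp: power_multiples_def)
    then have "(C V ^^ m) ((f [^]\<^bsub>sec X V\<^esub> n) \<odot>\<^bsub>msec M V\<^esub> (C V ^^ i) k)
        \<in> power_image m n (cartier_image X M C i K) V"
      by (intro subset_sheafify [OF V] iterate_closed smult_closed power_closed V fV kV) simp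
    then show "(C V ^^ (m + i)) x \<in> power_image m n (cartier_image X M C i K) V"
      unfolding x exchange [OF V fV kV] .
  qed
qed

lemma power_image_cong:
  assumes "subsheaf_eq X N N'"
  shows "power_image m n N U = power_image m n N' U"
  using assms by (intro sheafify_cong) (simp add: subsheaf_eq_def power_multiples_def)

text \<open>
  Values at sets that are not open carry no information; with the default value \<open>{}\<close> there, equality
  of subsheaves becomes equality of functions, and inclusion becomes their order.
\<close>

definition power_image_on_opens :: "nat \<Rightarrow> nat \<Rightarrow> 'a set \<Rightarrow> 'm set" where
  "power_image_on_opens m n U = (if opn U then power_image m n K U else {})"

lemma power_image_on_opens_eq_iff:
  "power_image_on_opens m n = power_image_on_opens m' n' \<longleftrightarrow>
   (\<forall>U. opn U \<longrightarrow> power_image m n K U = power_image m' n' K U)"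
  by (auto simp: power_image_on_opens_def fun_eq_iff)

lemma filtration:
  assumes "q > 1"
  shows "q_adic_filtration q power_image_on_opens"
proof
  show "power_image_on_opens m (Suc n) \<le> power_image_on_opens m n" for m n
    using power_image_antitone by (simp add: power_image_on_opens_def le_fun_def)
  fix m n assume "power_image_on_opens m n = power_image_on_opens m (Suc n)"
  then have eq: "power_image m n K V \<subseteq> power_image m (Suc n) K V" if "opn V" for V
    using that by (simp add: power_image_on_opens_eq_iff)
  have "power_image m (Suc n + k) K U \<subseteq> power_image m (n + k) K U" if "opn U" for m k U
    using power_image_antitone [OF that, of m "n + k"] by simp
  then show "power_image_on_opens m (n + q ^ m) = power_image_on_opens m (Suc n + q ^ m)"
    unfolding power_image_on_opens_eq_iff using power_image_translate [OF eq] by blast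
  show "power_image_on_opens (Suc m) n = power_image_on_opens (Suc m) (Suc n)"
    unfolding power_image_on_opens_eq_iff
    using power_image_persist [OF eq] power_image_antitone by blast
qed (rule assms)

lemma nu_eq_jumps:
  assumes "q > 1"
  shows "nu X M C \<I> m K = q_adic_filtration.jumps power_image_on_opens m"
  by (simp add: q_adic_filtration.jumps_def [OF filtration [OF assms]] nu_def subsheaf_eq_def
      cartier_image_ideal_pow power_image_on_opens_eq_iff del: ideal_pow.simps)

lemma power_image_on_opens_period:
  assumes "subsheaf_eq X (cartier_image X M C i K) (cartier_image X M C (i + j) K)"
  shows "power_image_on_opens (m + i) (q ^ i * n) = power_image_on_opens (m + i + j) (q ^ (i + j) * n)"
  unfolding power_image_on_opens_eq_iff
proof (intro allI impI)
  fix U assume U: "opn U"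
  have "power_image (m + i) (q ^ i * n) K U = power_image m n (cartier_image X M C i K) U"
    by (rule power_image_cartier_image [OF U, symmetric])
  also have "\<dots> = power_image m n (cartier_image X M C (i + j) K) U"
    by (rule power_image_cong [OF assms])
  also have "\<dots> = power_image (m + (i + j)) (q ^ (i + j) * n) K U"
    by (rule power_image_cartier_image [OF U])
  finally show "power_image (m + i) (q ^ i * n) K U = power_image (m + i + j) (q ^ (i + j) * n) K U"
    by (simp only: add.assoc)
qed

text \<open>
  This lets \<open>K = C^j(K)\<close> be used as preperiodicity with an empty pre-period.
\<close>

lemma cartier_image_0:
  "subsheaf_eq X (cartier_image X M C 0 K) K"
proof -
  have "x \<in> K U" if "opn U" "x \<in> carrier (msec M U)" "locally_on (pts X) U (\<lambda>V. mres M U V x \<in> K V)" for U x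
    using submodules that by (simp add: submodule_sheaf_def)
  then show ?thesis
    using K_carrier by (auto simp: subsheaf_eq_def cartier_image_def mres_self intro: locally_on_self)
qed

lemma nu_infty_rational:
  fixes p e i j L :: nat
  assumes "p > 1" "q = p ^ e" "e > 0" "j > 0"
    and period: "subsheaf_eq X (cartier_image X M C i K) (cartier_image X M C (i + j) K)"
    and bound: "\<And>m. m \<ge> 1 \<Longrightarrow> card (nu X M C \<I> m K \<inter> {0..<q ^ m}) \<le> L"
  shows "nu_infty p q X M C \<I> K \<subseteq> rats_in_Zp p (Z_localized p)"
    and "i = 0 \<Longrightarrow> nu_infty p q X M C \<I> K \<subseteq> rats_in_Zp p (Z_localized p \<inter> {-1..0})"
proof -
  have q: "q > 1" unfolding assms(2) by (rule one_less_power [OF assms(1,3)])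
  interpret q_adic_filtration q power_image_on_opens by (rule filtration [OF q])
  interpret preperiodic_filtration q power_image_on_opens i j L
    by unfold_locales
      (use assms(4) power_image_on_opens_period [OF period] bound in
        \<open>simp_all add: low_jumps_def nu_eq_jumps [OF q]\<close>)
  have carrier: "\<alpha> \<in> carrier (Zp p)" if "\<alpha> \<in> nu_infty p q X M C \<I> K" for \<alpha>
    using that by (simp add: nu_infty_def)
  have limit: "\<exists>n\<in>jumps m. \<alpha> (e * m) = int n mod int (q ^ m)"
    if lim: "\<alpha> \<in> nu_infty p q X M C \<I> K" and m: "m \<ge> 1" for \<alpha> m
  proof -
    obtain n where n: "n \<in> jumps m"
      "\<alpha> \<ominus>\<^bsub>Zp p\<^esub> Zp_of_int p (int n) \<in> PIdl\<^bsub>Zp p\<^esub> (Zp_of_int p (int (q ^ m)))"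
      using lim m unfolding nu_infty_def nu_eq_jumps [OF q] by blast
    have "int (q ^ m) = int p ^ (e * m)" by (simp add: assms(2) power_mult)
    then have "\<alpha> (e * m) = int n mod int (q ^ m)"
      using Zp_residue_of_diff_in_PIdl [OF _ carrier [OF lim], of "int n" "e * m"] n(2) assms(1)
      by simp
    then show ?thesis using n(1) by blast
  qed
  show "nu_infty p q X M C \<I> K \<subseteq> rats_in_Zp p (Z_localized p)"
    by (intro subsetI jump_limits_rational(1) [OF assms(1-3)] carrier limit)
  show "nu_infty p q X M C \<I> K \<subseteq> rats_in_Zp p (Z_localized p \<inter> {-1..0})" if "i = 0"
    by (intro subsetI jump_limits_rational(2) [OF assms(1-3) _ _ that] carrier limit)
qed

end

section \<open>Rationality of limits of jumps\<close>

theorem theorem2p18: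
  fixes p q :: nat and L :: real
    and X :: "('a, 'b) ringed_space"
    and \<I> :: "'a set \<Rightarrow> 'b set"
    and M :: "('a, 'b, 'm) mod_sheaf"
    and C :: "'a set \<Rightarrow> 'm \<Rightarrow> 'm"
    and N :: "'a set \<Rightarrow> 'm set"
  assumes "Factorial_Ring.prime p" and "\<exists>e>0. q = p ^ e"
    and "noetherian_scheme X" and "Fp_scheme p X" and "F_finite p X"
    and "ideal_sheaf X \<I>" and "quasi_coherent X (as_mod_sheaf (struct_sheaf X) \<I>)"
    and "locally_principal X \<I>"
    and "cartier_module q X M C" and "coherent X M"
    and "submodule_sheaf X M N" and "coherent X (as_mod_sheaf M N)"
    and "preperiodic X M C N"
    and "L \<ge> 0"
    and "\<And>m. m \<ge> 1 \<Longrightarrow> real (card (nu X M C \<I> m N \<inter> {0..<q ^ m})) \<le> L"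
  shows "nu_infty p q X M C \<I> N \<subseteq> rats_in_Zp p (Z_localized p) \<and>
    ((\<exists>j>0. subsheaf_eq X N (cartier_image X M C j N)) \<longrightarrow>
      nu_infty p q X M C \<I> N \<subseteq> rats_in_Zp p (Z_localized p \<inter> {-1..0}))"
proof -
  interpret cartier_ideal_action X M \<I> N q C
    using assms(3,6,8,9,11)
    by unfold_locales (simp_all add: noetherian_scheme_def scheme_def cartier_module_def)
  have p: "p > 1" using assms(1) by (rule prime_gt_1_nat)
  obtain e where e: "q = p ^ e" "e > 0" using assms(2) by blast
  have bound: "card (nu X M C \<I> m N \<inter> {0..<q ^ m}) \<le> nat \<lfloor>L\<rfloor>" if "m \<ge> 1" for m
    using assms(15) [OF that] by (rule le_nat_floor)
  obtain i j where ij: "j > 0"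
    "subsheaf_eq X (cartier_image X M C i N) (cartier_image X M C (i + j) N)"
    using assms(13) by (auto simp: preperiodic_def)
  have "nu_infty p q X M C \<I> N \<subseteq> rats_in_Zp p (Z_localized p \<inter> {-1..0})"
    if "j > 0" "subsheaf_eq X N (cartier_image X M C j N)" for j
  proof -
    have "subsheaf_eq X (cartier_image X M C 0 N) (cartier_image X M C (0 + j) N)"
      using that(2) cartier_image_0 by (simp add: subsheaf_eq_def)
    from nu_infty_rational(2) [OF p e that(1) this bound] show ?thesis by simp
  qed
  with nu_infty_rational(1) [OF p e ij bound] show ?thesis by blast
qed

end
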